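(* Let $1\le p\le\infty$ and let $w:\mathbb J\to[0,\infty)$ be measurable such that there is a real $c$ with $$w(t+h)\le c\,w(t)\quad\text{and}\quad w(t)\le c\,w(t+h)\quad\text{for a.e. } t\in\mathbb J,\ \text{ for } 0<h\le1 .$$ Then $L^p_w(\mathbb J,X)$ satisfies $(\Delta)$.
   Context: $X$ is a Banach space; $\mathbb J$ is an interval of the form $\mathbb R$, $(\alpha,\infty)$ or $[\alpha,\infty)$, $\alpha\in\mathbb R$. Measurable means Lebesgue (strongly) measurable, integrals are Bochner integrals. $|f|(t)=\|f(t)\|$. For $1\le p<\infty$, $L^p_w(\mathbb J,X)=\{f:\mathbb J\to X\text{ measurable}: w|f|^p\in L^1(\mathbb J,\mathbb R)\}$; $L^\infty_w(\mathbb J,X)=\{f:\mathbb J\to X\text{ measurable}: w|f|\text{ is measurable and bounded a.e.}\}$. For $h>0$: $\Delta_h\phi(t)=\phi(t+h)-\phi(t)$ and $M_h\phi(t)=\frac1h\int_0^h\phi(t+s)\,ds$. A class $\mathcal A$ of functions $\mathbb J\to X$ satisfies $(\Delta)$ if: whenever $\phi\in L^1_{loc}(\mathbb J,X)$ and $\Delta_s\phi\in\mathcal A$ for all $s>0$, then $\phi-M_h\phi\in\mathcal A$ for all $h>0$. *)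

theory Defs
  imports "HOL-Analysis.Analysis"
begin

text \<open>
  The library's Bochner integral is restricted to second countable (i.e. separable) target
  spaces.  To cover arbitrary Banach spaces we restate its definition with strong measurability
  in place of Borel measurability; the lemmas below show that both versions agree
  in the separable case.
\<close>

definition strongly_measurable :: "'a measure \<Rightarrow> ('a \<Rightarrow> 'b::real_normed_vector) \<Rightarrow> bool" where
  "strongly_measurable M f \<longleftrightarrow>
    (\<exists>s. (\<forall>i::nat. simple_function M (s i)) \<and> (AE x in M. (\<lambda>i. s i x) \<longlonglongrightarrow> f x))"

definition has_Bochner_int :: "'a measure \<Rightarrow> ('a \<Rightarrow> 'b::real_normed_vector) \<Rightarrow> 'b \<Rightarrow> bool" where
  "has_Bochner_int M f x \<longleftrightarrow> strongly_measurable M f \<and>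
    (\<exists>s. (\<forall>i::nat. Bochner_Integration.simple_bochner_integrable M (s i)) \<and>
         (\<lambda>i. \<integral>\<^sup>+y. ennreal (norm (f y - s i y)) \<partial>M) \<longlonglongrightarrow> 0 \<and>
         (\<lambda>i. Bochner_Integration.simple_bochner_integral M (s i)) \<longlonglongrightarrow> x)"

definition Bochner_integrable :: "'a measure \<Rightarrow> ('a \<Rightarrow> 'b::real_normed_vector) \<Rightarrow> bool" where
  "Bochner_integrable M f \<longleftrightarrow> (\<exists>x. has_Bochner_int M f x)"

definition Bochner_int :: "'a measure \<Rightarrow> ('a \<Rightarrow> 'b::real_normed_vector) \<Rightarrow> 'b" where
  "Bochner_int M f = (if Bochner_integrable M f then THE x. has_Bochner_int M f x else 0)"

lemma (in complete_measure) strongly_measurable_iff_borel_measurable: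
  fixes f :: "'a \<Rightarrow> 'b::{real_normed_vector, second_countable_topology}"
  shows "strongly_measurable M f \<longleftrightarrow> f \<in> borel_measurable M"
proof
  assume "f \<in> borel_measurable M"
  from borel_measurable_implies_sequence_metric[OF this, of 0]
  obtain s where s: "\<forall>i. simple_function M (s i)" "\<forall>x\<in>space M. (\<lambda>i. s i x) \<longlonglongrightarrow> f x"
    by auto
  then have "AE x in M. (\<lambda>i. s i x) \<longlonglongrightarrow> f x"
    by simp
  with s show "strongly_measurable M f"
    unfolding strongly_measurable_def by blast
next
  assume "strongly_measurable M f"
  then obtain s where s: "\<And>i::nat. simple_function M (s i)"
    and "AE x in M. (\<lambda>i. s i x) \<longlonglongrightarrow> f x"
    unfolding strongly_measurable_def by blast
  then obtain N where N: "N \<in> null_sets M"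
    and lim: "\<And>x. x \<in> space M - N \<Longrightarrow> (\<lambda>i. s i x) \<longlonglongrightarrow> f x"
    by (auto elim!: AE_E3)
  have Ns: "N \<in> sets M" using N by auto
  define g where "g x = (if x \<in> N then 0 else f x)" for x
  have g: "g \<in> borel_measurable M"
  proof (rule borel_measurable_LIMSEQ_metric)
    fix i show "(\<lambda>x. if x \<in> N then 0 else s i x) \<in> borel_measurable M"
      using borel_measurable_simple_function[OF s[of i]] Ns
      by (intro measurable_If_set) (auto simp: sets.Int_space_eq1)
  next
    fix x assume "x \<in> space M"
    then show "(\<lambda>i. if x \<in> N then 0 else s i x) \<longlonglongrightarrow> g x"
      using lim[of x] by (auto simp: g_def)
  qed
  show "f \<in> borel_measurable M"
  proof (rule measurableI)
    fix A :: "'b set" assume A: "A \<in> sets borel"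
    have "f -` A \<inter> space M = (g -` A \<inter> space M - N) \<union> (f -` A \<inter> space M \<inter> N)"
      by (auto simp: g_def)
    moreover have "f -` A \<inter> space M \<inter> N \<in> sets M"
      using complete[of "f -` A \<inter> space M \<inter> N" N] N by auto
    ultimately show "f -` A \<inter> space M \<in> sets M"
      using measurable_sets[OF g A] Ns by (metis sets.Diff sets.Un)
  qed auto
qed

lemma (in complete_measure) has_Bochner_int_iff_has_bochner_integral:
  fixes f :: "'a \<Rightarrow> 'b::{real_normed_vector, second_countable_topology}"
  shows "has_Bochner_int M f x \<longleftrightarrow> has_bochner_integral M f x"
  unfolding has_Bochner_int_def has_bochner_integral.simps strongly_measurable_iff_borel_measurable
  by blast

text \<open>
  Functions on an interval \<open>J\<close> are represented by total functions on the reals; every notion below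
  only depends on the values on \<open>J\<close>.
\<close>

definition L1_loc :: "real set \<Rightarrow> (real \<Rightarrow> 'a::banach) set" where
  "L1_loc J = {f. strongly_measurable (lebesgue_on J) f \<and>
    (\<forall>K. compact K \<and> K \<subseteq> J \<longrightarrow> Bochner_integrable (lebesgue_on K) f)}"

definition Lp_w :: "ennreal \<Rightarrow> (real \<Rightarrow> real) \<Rightarrow> real set \<Rightarrow> (real \<Rightarrow> 'a::banach) set" where
  "Lp_w p w J = {f. strongly_measurable (lebesgue_on J) f \<and>
    (if p = \<infinity>
     then (\<lambda>t. w t * norm (f t)) \<in> borel_measurable (lebesgue_on J) \<and>
          (\<exists>C. AE t in lebesgue_on J. \<bar>w t * norm (f t)\<bar> \<le> C)
     else integrable (lebesgue_on J) (\<lambda>t. w t * norm (f t) powr enn2real p))}"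

definition diff_op :: "real \<Rightarrow> (real \<Rightarrow> 'a::banach) \<Rightarrow> real \<Rightarrow> 'a" where
  "diff_op h \<phi> t = \<phi> (t + h) - \<phi> t"

definition mean_op :: "real \<Rightarrow> (real \<Rightarrow> 'a::banach) \<Rightarrow> real \<Rightarrow> 'a" where
  "mean_op h \<phi> t = (1 / h) *\<^sub>R Bochner_int (lebesgue_on {0..h}) (\<lambda>s. \<phi> (t + s))"

definition satisfies_Delta :: "real set \<Rightarrow> (real \<Rightarrow> 'a::banach) set \<Rightarrow> bool" where
  "satisfies_Delta J A \<longleftrightarrow>
    (\<forall>\<phi>\<in>L1_loc J. (\<forall>s>0. diff_op s \<phi> \<in> A) \<longrightarrow> (\<forall>h>0. (\<lambda>t. \<phi> t - mean_op h \<phi> t) \<in> A))"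

end

theory Submission
  imports Defs
begin

text \<open>
  The deviation from the mean is an average of increments,
  \<open>\<phi> - mean_op h \<phi> = - (1 / h) \<integral>\<^sub>0\<^sup>h \<Delta>\<^sub>s \<phi> ds\<close>. By Jensen's inequality and Tonelli's theorem it lies in
  the weighted space as soon as the weighted norm \<open>F s\<close> of \<open>\<Delta>\<^sub>s \<phi>\<close> is bounded for \<open>0 < s \<le> h\<close>. The
  hypothesis only says that \<open>F s\<close> is finite for each \<open>s > 0\<close>, so the point is to make this uniform,
  in particular as \<open>s\<close> tends to \<open>0\<close>.

  The identity \<open>\<Delta>\<^sub>s \<phi> (x) = \<Delta>\<^bsub>r + s\<^esub> \<phi> (x) - \<Delta>\<^sub>r \<phi> (x + s)\<close> (lemma \<open>increment_le\<close>) and the growth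
  condition on the weight bound \<open>F s\<close> by a multiple of \<open>F (r + s) + F r\<close>, for every \<open>r > 0\<close>. The function
  \<open>F\<close> is measurable and finite, so for large \<open>N\<close> the set where \<open>F > N\<close> has measure less than \<open>h / 2\<close> in
  \<open>{0<..2 * h}\<close>. Hence for every \<open>s\<close> in \<open>{0<..h}\<close> there is an \<open>r\<close> with \<open>F r \<le> N\<close> and \<open>F (r + s) \<le> N\<close>
  (\<open>ex_uniform_common_translate\<close>), and \<open>F\<close> is bounded on \<open>{0<..h}\<close>
  (\<open>weighted_increment_integral_bounded\<close>, and \<open>weighted_increment_essentially_bounded\<close> for \<open>p = \<infinity>\<close>).
  Since all steps go to the right, a half-line is treated like the whole line.

  The rest is measure theory with values in a Banach space that may be nonseparable. Measurability
  of \<open>F\<close> and Tonelli's theorem require \<open>norm (\<phi> (x + s) - \<phi> x)\<close> to be jointly measurable; for this \<open>\<phi>\<close> is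
  replaced by a Borel model, a pointwise limit of Borel simple functions
  (\<open>strongly_measurable_ex_simple_approximation\<close>). The mean is a pointwise limit of window
  integrals of these simple functions, and limits preserve strong measurability
  (\<open>strongly_measurable_LIMSEQ\<close>).
\<close>

section \<open>Strong measurability\<close>

lemma complete_measure_lebesgue_on:
  "S \<in> sets lebesgue \<Longrightarrow> complete_measure (lebesgue_on S)"
proof
  fix A B :: "'a set"
  assume S: "S \<in> sets lebesgue" and "B \<subseteq> A" "A \<in> null_sets (lebesgue_on S)"
  then have "B \<in> null_sets lebesgue" "B \<subseteq> S"
    using null_sets_completion_subset[of B A lborel] by (auto simp: null_sets_restrict_space)
  then show "B \<in> sets (lebesgue_on S)"
    using S by (auto simp: sets_restrict_space_iff null_sets_def)
qed

lemma strongly_measurable_simple: "simple_function M f \<Longrightarrow> strongly_measurable M f"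
  unfolding strongly_measurable_def by (intro exI[of _ "\<lambda>_. f"]) auto

lemma strongly_measurable_cong_AE:
  assumes "strongly_measurable M f" "AE x in M. f x = g x"
  shows "strongly_measurable M g"
proof -
  obtain s where s: "\<And>i::nat. simple_function M (s i)" "AE x in M. (\<lambda>i. s i x) \<longlonglongrightarrow> f x"
    using assms(1) unfolding strongly_measurable_def by blast
  from s(2) assms(2) have "AE x in M. (\<lambda>i. s i x) \<longlonglongrightarrow> g x"
    by eventually_elim simp
  with s(1) show ?thesis unfolding strongly_measurable_def by blast
qed

lemma strongly_measurable_compose2:
  assumes "strongly_measurable M f" "strongly_measurable M g"
    and cont: "continuous_on UNIV (\<lambda>z. q (fst z) (snd z))"
  shows "strongly_measurable M (\<lambda>x. q (f x) (g x))"
proof -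
  obtain s where s: "\<And>i::nat. simple_function M (s i)" "AE x in M. (\<lambda>i. s i x) \<longlonglongrightarrow> f x"
    using assms(1) unfolding strongly_measurable_def by blast
  obtain t where t: "\<And>i::nat. simple_function M (t i)" "AE x in M. (\<lambda>i. t i x) \<longlonglongrightarrow> g x"
    using assms(2) unfolding strongly_measurable_def by blast
  have "AE x in M. (\<lambda>i. q (s i x) (t i x)) \<longlonglongrightarrow> q (f x) (g x)"
    using s(2) t(2)
  proof eventually_elim
    case (elim x)
    have "(\<lambda>i. (s i x, t i x)) \<longlonglongrightarrow> (f x, g x)" by (intro tendsto_Pair elim)
    from continuous_on_tendsto_compose[OF cont this] show ?case by simp
  qed
  moreover have "simple_function M (\<lambda>x. q (s i x) (t i x))" for i
    using s(1) t(1) by (rule simple_function_compose2)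
  ultimately show ?thesis
    unfolding strongly_measurable_def by (intro exI[of _ "\<lambda>i x. q (s i x) (t i x)"]) auto
qed

lemma strongly_measurable_diff:
  "strongly_measurable M f \<Longrightarrow> strongly_measurable M g \<Longrightarrow> strongly_measurable M (\<lambda>x. f x - g x)"
  by (rule strongly_measurable_compose2[where q="(-)"]) (intro continuous_intros | assumption)+

lemma strongly_measurable_add:
  "strongly_measurable M f \<Longrightarrow> strongly_measurable M g \<Longrightarrow> strongly_measurable M (\<lambda>x. f x + g x)"
  by (rule strongly_measurable_compose2[where q="(+)"]) (intro continuous_intros | assumption)+

lemma strongly_measurable_scaleR:
  "strongly_measurable M f \<Longrightarrow> strongly_measurable M g \<Longrightarrow> strongly_measurable M (\<lambda>x. f x *\<^sub>R g x)"
  by (rule strongly_measurable_compose2[where q="scaleR"]) (intro continuous_intros | assumption)+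

lemma strongly_measurable_sum:
  "finite I \<Longrightarrow> (\<And>i. i \<in> I \<Longrightarrow> strongly_measurable M (f i)) \<Longrightarrow>
    strongly_measurable M (\<lambda>x. \<Sum>i\<in>I. f i x)"
  by (induction I rule: finite_induct)
     (auto intro: strongly_measurable_add strongly_measurable_simple)

lemma (in complete_measure) borel_measurable_norm_diff_strongly:
  assumes "strongly_measurable M f" "strongly_measurable M g"
  shows "(\<lambda>x. norm (f x - g x)) \<in> borel_measurable M"
proof -
  have "strongly_measurable M (\<lambda>x. norm (f x - g x))"
    using assms
    by (rule strongly_measurable_compose2[where q="\<lambda>x y. norm (x - y)"]) (intro continuous_intros)
  then show ?thesis by (simp add: strongly_measurable_iff_borel_measurable)
qed

text \<open>
  A form of Pettis' measurability theorem. Enumerating a countable set whose closure contains the range,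
  one approximates \<open>f x\<close> by the best of the first \<open>n + 1\<close> points; this choice depends measurably
  on \<open>x\<close> because it only compares real functions. The criterion mentions Borel measurability of
  real functions only, and so it applies in a nonseparable space.
\<close>

lemma strongly_measurable_separable_range:
  fixes f :: "'a \<Rightarrow> 'b::real_normed_vector"
  assumes D: "countable D" "\<And>x. x \<in> space M \<Longrightarrow> f x \<in> closure D"
    and meas: "\<And>d. d \<in> D \<Longrightarrow> (\<lambda>x. norm (f x - d)) \<in> borel_measurable M"
  shows "strongly_measurable M f"
proof (cases "D = {}")
  case True
  then have "space M = {}" using D by auto
  then have "simple_function M f" by (simp add: simple_function_def)
  then show ?thesis by (rule strongly_measurable_simple)
next
  case False
  define e where "e = from_nat_into D"
  have e: "e n \<in> D" for n unfolding e_def by (rule from_nat_into[OF False])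
  note [measurable] = meas[OF e]
  define P where "P n x k \<longleftrightarrow> k \<le> n \<and> (\<forall>j\<le>n. norm (f x - e k) \<le> norm (f x - e j))"
    for n x and k :: nat
  define k where "k n x = (LEAST k. P n x k)" for n x
  have P_k: "P n x (k n x)" for n x
  proof -
    obtain i where "i \<in> {..n}" "\<And>j. j \<in> {..n} \<Longrightarrow> norm (f x - e i) \<le> norm (f x - e j)"
      using ex_min_if_finite[of "(\<lambda>j. norm (f x - e j)) ` {..n}"]
      by (auto simp: not_less)
    then have "P n x i" unfolding P_def by auto
    then show ?thesis unfolding k_def by (rule LeastI)
  qed
  have k_meas: "k n \<in> measurable M (count_space UNIV)" for n
    unfolding k_def P_def by measurable
  have simple: "simple_function M (\<lambda>x. e (k n x))" for n
  proof -
    have "k n ` space M \<subseteq> {..n}" using P_k unfolding P_def by auto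
    then have "simple_function M (k n)"
      unfolding simple_function_def using measurable_sets[OF k_meas]
      by (auto intro: finite_subset)
    then show ?thesis by (rule simple_function_compose1)
  qed
  have "(\<lambda>n. e (k n x)) \<longlonglongrightarrow> f x" if x: "x \<in> space M" for x
  proof (rule metric_LIMSEQ_I)
    fix r :: real assume "0 < r"
    then obtain d where d: "d \<in> D" "dist d (f x) < r"
      using D(2)[OF x] by (auto simp: closure_approachable)
    then obtain m where m: "d = e m"
      using from_nat_into_surj[OF D(1)] unfolding e_def by metis
    have "dist (e (k n x)) (f x) < r" if "n \<ge> m" for n
    proof -
      have "norm (f x - e (k n x)) \<le> norm (f x - e m)"
        using P_k[of n x] that unfolding P_def by blast
      then show ?thesis using d(2) unfolding m dist_norm by (simp add: norm_minus_commute)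
    qed
    then show "\<exists>m. \<forall>n\<ge>m. dist (e (k n x)) (f x) < r" by blast
  qed
  then show ?thesis
    unfolding strongly_measurable_def using simple by (intro exI[of _ "\<lambda>n x. e (k n x)"]) auto
qed

text \<open>
  Almost everywhere \<open>u i\<close> takes its values in the closure of the countable set of all values of the
  simple approximants, and so does the limit.
\<close>

lemma (in complete_measure) strongly_measurable_LIMSEQ:
  fixes f :: "'a \<Rightarrow> 'b::real_normed_vector"
  assumes u: "\<And>i::nat. strongly_measurable M (u i)"
    and lim: "AE x in M. (\<lambda>i. u i x) \<longlonglongrightarrow> f x"
  shows "strongly_measurable M f"
proof -
  from u have "\<forall>i. \<exists>s. (\<forall>n::nat. simple_function M (s n)) \<and> (AE x in M. (\<lambda>n. s n x) \<longlonglongrightarrow> u i x)"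
    unfolding strongly_measurable_def by blast
  then obtain s where s: "\<And>i n::nat. simple_function M (s i n)"
    and s_lim: "\<And>i. AE x in M. (\<lambda>n. s i n x) \<longlonglongrightarrow> u i x"
    by metis
  have "AE x in M. (\<forall>i. (\<lambda>n. s i n x) \<longlonglongrightarrow> u i x) \<and> (\<lambda>i. u i x) \<longlonglongrightarrow> f x"
    using s_lim lim by (simp add: AE_all_countable)
  then obtain N where N: "N \<in> null_sets M"
    and N_lim: "\<And>x i. x \<in> space M - N \<Longrightarrow> (\<lambda>n. s i n x) \<longlonglongrightarrow> u i x"
      "\<And>x. x \<in> space M - N \<Longrightarrow> (\<lambda>i. u i x) \<longlonglongrightarrow> f x"
    by (elim AE_E3) blast
  \<comment> \<open>On the exceptional null set everything is set to \<open>0\<close>, so that the limits hold at every point.\<close>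
  define u' where "u' i x = (if x \<in> N then 0 else u i x)" for i x
  define f' where "f' x = (if x \<in> N then 0 else f x)" for x
  define D where "D = insert 0 (\<Union>i. \<Union>n. s i n ` space M)"
  have notN: "AE x in M. x \<notin> N" using N by (rule AE_not_in)
  have u': "strongly_measurable M (u' i)" for i
    by (rule strongly_measurable_cong_AE[OF u[of i]]) (use notN in eventually_elim, auto simp: u'_def)
  have u'_lim: "(\<lambda>i. u' i x) \<longlonglongrightarrow> f' x" if "x \<in> space M" for x
    using N_lim(2)[of x] that by (auto simp: u'_def f'_def)
  have "strongly_measurable M f'"
  proof (rule strongly_measurable_separable_range)
    show "countable D"
      unfolding D_def
      by (intro countable_insert countable_UN countable_finite[OF simple_functionD(1)[OF s]]) auto
    show "f' x \<in> closure D" if x: "x \<in> space M" for x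
    proof (cases "x \<in> N")
      case True
      then show ?thesis unfolding f'_def D_def by (auto intro: closure_subset[THEN subsetD])
    next
      case False
      have "u i x \<in> closure D" for i
        by (rule Lim_in_closed_set[OF closed_closure _ _ N_lim(1)[of x i]])
           (use x False in \<open>auto simp: D_def intro!: always_eventually closure_subset[THEN subsetD]\<close>)
      then have "f x \<in> closure D"
        using N_lim(2)[of x] x False
        by (intro Lim_in_closed_set[OF closed_closure, of "\<lambda>i. u i x" _ sequentially]) auto
      then show ?thesis using False by (simp add: f'_def)
    qed
    show "(\<lambda>x. norm (f' x - d)) \<in> borel_measurable M" for d
    proof (rule borel_measurable_LIMSEQ_metric)
      show "(\<lambda>x. norm (u' i x - d)) \<in> borel_measurable M" for i
        by (intro borel_measurable_norm_diff_strongly u' strongly_measurable_simple) simp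
      show "(\<lambda>i. norm (u' i x - d)) \<longlonglongrightarrow> norm (f' x - d)" if "x \<in> space M" for x
        by (intro tendsto_intros u'_lim that)
    qed
  qed
  then show ?thesis
    by (rule strongly_measurable_cong_AE) (use notN in eventually_elim, auto simp: f'_def)
qed

section \<open>The Bochner integral as a limit of simple integrals\<close>

text \<open>
  In a nonseparable space \<open>f\<close> and the differences \<open>f - s\<close> may fail to be Borel measurable, but their
  norms are measurable on a complete space, and the triangle inequality for the two integrals needs
  no more than that.
\<close>

lemma (in complete_measure) simple_bochner_integral_dist_le:
  fixes f :: "'a \<Rightarrow> 'b::real_normed_vector"
  assumes f: "strongly_measurable M f"
  assumes s: "Bochner_Integration.simple_bochner_integrable M s"
    and t: "Bochner_Integration.simple_bochner_integrable M t"
  shows "ennreal (norm (Bochner_Integration.simple_bochner_integral M s -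
      Bochner_Integration.simple_bochner_integral M t)) \<le>
    (\<integral>\<^sup>+ x. norm (f x - s x) \<partial>M) + (\<integral>\<^sup>+ x. norm (f x - t x) \<partial>M)"
    (is "ennreal (norm (?s - ?t)) \<le> ?S + ?T")
proof -
  have st: "simple_function M s" "simple_function M t"
    using s t by (auto elim: Bochner_Integration.simple_bochner_integrable.cases)
  have d: "Bochner_Integration.simple_bochner_integrable M (\<lambda>x. s x - t x)"
    using Bochner_Integration.simple_bochner_integrable_compose2[of "(-)" M s t] s t by simp
  have "ennreal (norm (?s - ?t)) =
      norm (Bochner_Integration.simple_bochner_integral M (\<lambda>x. s x - t x))"
    using s t by (simp add: Bochner_Integration.simple_bochner_integral_diff)
  also have "\<dots> \<le> Bochner_Integration.simple_bochner_integral M (\<lambda>x. norm (s x - t x))"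
    using d by (intro ennreal_leI Bochner_Integration.simple_bochner_integral_norm_bound)
  also have "\<dots> = (\<integral>\<^sup>+x. norm (s x - t x) \<partial>M)"
    using Bochner_Integration.simple_bochner_integrable_compose2[of "\<lambda>x y. norm (x - y)" M s t] s t
    by (auto intro!: Bochner_Integration.simple_bochner_integral_eq_nn_integral)
  also have "\<dots> \<le> (\<integral>\<^sup>+x. ennreal (norm (f x - s x)) + ennreal (norm (f x - t x)) \<partial>M)"
  proof (rule nn_integral_mono)
    fix x
    have "norm (s x - t x) \<le> norm (f x - s x) + norm (f x - t x)"
      by (metis dual_order.refl norm_diff_triangle_le norm_minus_commute)
    then show "ennreal (norm (s x - t x)) \<le> ennreal (norm (f x - s x)) + ennreal (norm (f x - t x))"
      by (metis ennreal_leI ennreal_plus norm_ge_zero)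
  qed
  also have "\<dots> = ?S + ?T"
    by (intro nn_integral_add measurable_compose[OF _ measurable_ennreal]
        borel_measurable_norm_diff_strongly f strongly_measurable_simple[OF st(1)]
        strongly_measurable_simple[OF st(2)])
  finally show ?thesis .
qed

text \<open>
  The simple integrals form a Cauchy sequence by the preceding estimate, and the same estimate shows
  that two approximating sequences have the same limit; hence the definite description that defines
  the integral picks this limit.
\<close>

lemma (in complete_measure) Bochner_int_LIMSEQ:
  fixes f :: "'a \<Rightarrow> 'b::banach"
  assumes f: "strongly_measurable M f"
    and s: "\<And>i. Bochner_Integration.simple_bochner_integrable M (s i)"
    and lim: "(\<lambda>i. \<integral>\<^sup>+x. ennreal (norm (f x - s i x)) \<partial>M) \<longlonglongrightarrow> 0"
  shows "(\<lambda>i. Bochner_Integration.simple_bochner_integral M (s i)) \<longlonglongrightarrow> Bochner_int M f"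
proof -
  let ?I = "Bochner_Integration.simple_bochner_integral M"
  let ?d = "\<lambda>s i. \<integral>\<^sup>+x. ennreal (norm (f x - s i x)) \<partial>M"
  have dist_lim: "(\<lambda>i. ?I (t i) - ?I (t' i)) \<longlonglongrightarrow> 0"
    if t: "\<And>i::nat. Bochner_Integration.simple_bochner_integrable M (t i)"
        "\<And>i. Bochner_Integration.simple_bochner_integrable M (t' i)"
      and "?d t \<longlonglongrightarrow> 0" "?d t' \<longlonglongrightarrow> 0" for t t'
  proof -
    have "(\<lambda>i. ?d t i + ?d t' i) \<longlonglongrightarrow> 0 + 0" by (intro tendsto_add that)
    then have "(\<lambda>i. ?d t i + ?d t' i) \<longlonglongrightarrow> 0" by simp
    then have "(\<lambda>i. ennreal (norm (?I (t i) - ?I (t' i)))) \<longlonglongrightarrow> 0"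
      by (rule tendsto_sandwich[OF _ _ tendsto_const, rotated 2])
         (intro always_eventually allI zero_le simple_bochner_integral_dist_le[OF f] t)+
    then have "(\<lambda>i. norm (?I (t i) - ?I (t' i))) \<longlonglongrightarrow> 0"
      by (simp add: tendsto_ennreal_iff flip: ennreal_0)
    then show ?thesis by (rule tendsto_norm_zero_cancel)
  qed
  have "Cauchy (\<lambda>i. ?I (s i))"
  proof (rule metric_CauchyI)
    fix r :: real assume "0 < r"
    then have "eventually (\<lambda>i. ?d s i < ennreal (r / 2)) sequentially"
      by (intro order_tendstoD[OF lim]) auto
    then obtain n where n: "\<And>i. i \<ge> n \<Longrightarrow> ?d s i < ennreal (r / 2)"
      by (auto simp: eventually_sequentially)
    have "dist (?I (s i)) (?I (s j)) < r" if "i \<ge> n" "j \<ge> n" for i j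
    proof -
      have "ennreal (dist (?I (s i)) (?I (s j))) \<le> ?d s i + ?d s j"
        using simple_bochner_integral_dist_le[OF f s s] by (simp add: dist_norm)
      also have "\<dots> < ennreal (r / 2) + ennreal (r / 2)"
        using that n by (intro add_strict_mono) auto
      also have "\<dots> = ennreal r" using \<open>0 < r\<close> by (simp flip: ennreal_plus)
      finally show ?thesis by (simp add: ennreal_less_iff)
    qed
    then show "\<exists>n. \<forall>i\<ge>n. \<forall>j\<ge>n. dist (?I (s i)) (?I (s j)) < r" by blast
  qed
  then obtain x where x: "(\<lambda>i. ?I (s i)) \<longlonglongrightarrow> x"
    by (auto simp: Cauchy_convergent_iff convergent_def)
  then have hx: "has_Bochner_int M f x"
    unfolding has_Bochner_int_def using f s lim by auto
  then have int: "Bochner_integrable M f" by (auto simp: Bochner_integrable_def)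
  have unique: "y = x" if y: "has_Bochner_int M f y" for y
  proof -
    have "\<exists>t. (\<forall>i::nat. Bochner_Integration.simple_bochner_integrable M (t i)) \<and>
        ?d t \<longlonglongrightarrow> 0 \<and> (\<lambda>i. ?I (t i)) \<longlonglongrightarrow> y"
      using y unfolding has_Bochner_int_def by (rule conjunct2)
    then obtain t where t: "(\<forall>i::nat. Bochner_Integration.simple_bochner_integrable M (t i)) \<and>
        ?d t \<longlonglongrightarrow> 0 \<and> (\<lambda>i. ?I (t i)) \<longlonglongrightarrow> y" ..
    note t = t[THEN conjunct1, rule_format] t[THEN conjunct2, THEN conjunct1]
      t[THEN conjunct2, THEN conjunct2]
    have "(\<lambda>i. ?I (t i) - ?I (s i)) \<longlonglongrightarrow> y - x"
      by (intro tendsto_diff t(3) x)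
    moreover have "(\<lambda>i. ?I (t i) - ?I (s i)) \<longlonglongrightarrow> 0"
      by (intro dist_lim[of t s] s t lim)
    ultimately have "y - x = 0" by (rule LIMSEQ_unique)
    then show ?thesis by simp
  qed
  have "Bochner_int M f = x"
    unfolding Bochner_int_def if_P[OF int] by (rule the_equality[where P="has_Bochner_int M f", OF hx unique])
  with x show "(\<lambda>i. ?I (s i)) \<longlonglongrightarrow> Bochner_int M f" by simp
qed

text \<open>
  Through this bound the vector-valued integral enters the norm estimates. The constant \<open>c\<close> is
  itself a simple function, so the bound is a limit of the estimate for two simple functions.
\<close>

lemma (in complete_measure) norm_const_diff_Bochner_int_le:
  fixes f :: "'a \<Rightarrow> 'b::banach"
  assumes fin: "emeasure M (space M) \<noteq> \<infinity>"
    and f: "strongly_measurable M f"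
    and s: "\<And>i. Bochner_Integration.simple_bochner_integrable M (s i)"
    and lim: "(\<lambda>i. \<integral>\<^sup>+x. ennreal (norm (f x - s i x)) \<partial>M) \<longlonglongrightarrow> 0"
  shows "ennreal (norm (measure M (space M) *\<^sub>R c - Bochner_int M f)) \<le> (\<integral>\<^sup>+x. norm (f x - c) \<partial>M)"
proof -
  let ?I = "Bochner_Integration.simple_bochner_integral M"
  have "emeasure M {y \<in> space M. c \<noteq> 0} \<le> emeasure M (space M)"
    by (intro emeasure_mono) auto
  with fin have c: "Bochner_Integration.simple_bochner_integrable M (\<lambda>_. c)"
    by (intro Bochner_Integration.simple_bochner_integrable.intros) (auto simp: top_unique)
  have I_c: "?I (\<lambda>_. c) = measure M (space M) *\<^sub>R c"
    unfolding Bochner_Integration.simple_bochner_integral_def 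
    by (cases "space M = {}") (simp_all add: image_constant_conv)
  have "(\<lambda>i. ennreal (norm (?I (\<lambda>_. c) - ?I (s i)))) \<longlonglongrightarrow>
      ennreal (norm (?I (\<lambda>_. c) - Bochner_int M f))"
    by (intro tendsto_intros tendsto_ennrealI Bochner_int_LIMSEQ f s lim)
  moreover have "(\<lambda>i. (\<integral>\<^sup>+x. norm (f x - c) \<partial>M) + (\<integral>\<^sup>+x. ennreal (norm (f x - s i x)) \<partial>M)) \<longlonglongrightarrow>
      (\<integral>\<^sup>+x. norm (f x - c) \<partial>M) + 0"
    by (intro tendsto_add tendsto_const lim)
  ultimately show ?thesis
    unfolding I_c[symmetric] add_0_right
    by (rule LIMSEQ_le) (intro exI allI impI simple_bochner_integral_dist_le f c s)
qed

section \<open>Lebesgue measure and translations\<close>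

lemma nn_integral_lebesgue_on:
  "S \<in> sets borel \<Longrightarrow> (\<integral>\<^sup>+x. f x \<partial>lebesgue_on S) = (\<integral>\<^sup>+x\<in>S. f x \<partial>lborel)"
  by (simp add: nn_integral_restrict_space nn_integral_completion)

lemma AE_lebesgue_on_iff:
  "S \<in> sets borel \<Longrightarrow> (AE x in lebesgue_on S. P x) \<longleftrightarrow> (AE x in lborel. x \<in> S \<longrightarrow> P x)"
  by (simp add: AE_restrict_space_iff AE_completion_iff)

lemma measurable_lebesgue_on:
  "f \<in> measurable borel M \<Longrightarrow> f \<in> measurable (lebesgue_on S) M"
  by (intro measurable_restrict_space1 measurable_completion) simp

lemma AE_lborel_translate:
  fixes t :: real
  assumes "AE x in lborel. P x"
  shows "AE x in lborel. P (t + x)"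
proof -
  obtain N where N: "N \<in> null_sets lborel" "\<And>x. x \<notin> N \<Longrightarrow> P x"
    using assms by (elim AE_E3) auto
  have [measurable]: "N \<in> sets borel" using N by (simp add: null_sets_def)
  have "AE x in lborel. t + 1 * x \<notin> N"
    by (rule AE_borel_affine) (use N in \<open>auto intro: AE_not_in\<close>)
  then show ?thesis by eventually_elim (use N in auto)
qed

lemma nn_integral_lborel_translate:
  fixes t :: real
  assumes "f \<in> borel_measurable borel"
  shows "(\<integral>\<^sup>+x. f (t + x) \<partial>lborel) = (\<integral>\<^sup>+x. f x \<partial>lborel)"
  using nn_integral_real_affine[OF assms, of 1 t] by simp

text \<open>
  The estimate \<open>norm (f x) \<le> norm (f x - s i x) + norm (s i x)\<close>, for a simple function \<open>s i\<close> whose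
  \<open>L\<^sup>1\<close> distance to \<open>f\<close> is less than \<open>1\<close>.
\<close>

lemma Bochner_integrable_imp_nn_integral_finite:
  assumes "complete_measure M" "Bochner_integrable M f"
  shows "(\<integral>\<^sup>+x. norm (f x) \<partial>M) < \<infinity>"
proof -
  interpret complete_measure M by fact
  obtain s where f: "strongly_measurable M f"
    and s: "\<And>i::nat. Bochner_Integration.simple_bochner_integrable M (s i)"
    and lim: "(\<lambda>i. \<integral>\<^sup>+x. ennreal (norm (f x - s i x)) \<partial>M) \<longlonglongrightarrow> 0"
    using assms(2) unfolding Bochner_integrable_def has_Bochner_int_def by blast
  have "eventually (\<lambda>i. (\<integral>\<^sup>+x. ennreal (norm (f x - s i x)) \<partial>M) < 1) sequentially"
    by (intro order_tendstoD[OF lim]) simp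
  then obtain i where i: "(\<integral>\<^sup>+x. ennreal (norm (f x - s i x)) \<partial>M) < 1"
    by (auto simp: eventually_sequentially)
  have si: "simple_function M (s i)"
    using s by (auto elim: Bochner_Integration.simple_bochner_integrable.cases)
  have "(\<integral>\<^sup>+x. ennreal (norm (s i x)) \<partial>M) =
      Bochner_Integration.simple_bochner_integral M (\<lambda>x. norm (s i x))"
    using Bochner_Integration.simple_bochner_integrable_compose2[of "\<lambda>x y. norm x" M "s i" "s i"] s
    by (intro Bochner_Integration.simple_bochner_integral_eq_nn_integral[symmetric]) auto
  then have fin: "(\<integral>\<^sup>+x. ennreal (norm (s i x)) \<partial>M) < \<infinity>" by simp
  have "(\<integral>\<^sup>+x. norm (f x) \<partial>M) \<le>
      (\<integral>\<^sup>+x. ennreal (norm (f x - s i x)) + ennreal (norm (s i x)) \<partial>M)"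
    by (intro nn_integral_mono)
       (simp add: norm_triangle_sub add.commute flip: ennreal_plus)
  also have "\<dots> = (\<integral>\<^sup>+x. ennreal (norm (f x - s i x)) \<partial>M) + (\<integral>\<^sup>+x. ennreal (norm (s i x)) \<partial>M)"
  proof (rule nn_integral_add)
    show "(\<lambda>x. ennreal (norm (f x - s i x))) \<in> borel_measurable M"
      by (intro measurable_compose[OF _ measurable_ennreal] borel_measurable_norm_diff_strongly f
          strongly_measurable_simple si)
    show "(\<lambda>x. ennreal (norm (s i x))) \<in> borel_measurable M"
      by (intro borel_measurable_simple_function simple_function_compose1[OF si])
  qed
  also have "\<dots> < \<infinity>"
    using i fin by (auto simp: less_top[symmetric])
  finally show ?thesis .
qed

section \<open>Borel models of strongly measurable functions\<close>

text \<open>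
  A Borel model of a strongly measurable function. The approximation by Borel simple functions at every
  single point makes \<open>norm (g y - g x)\<close> jointly Borel measurable in \<open>x\<close> and \<open>y\<close>; for a
  Lebesgue measurable function this would be problematic, because addition does not pull Lebesgue sets
  of the line back to product measurable sets. The bound by \<open>2 * norm (g x)\<close> lets dominated convergence
  apply to the approximants.
\<close>

locale simple_approximation =
  fixes g :: "real \<Rightarrow> 'a::banach" and \<psi> :: "nat \<Rightarrow> real \<Rightarrow> 'a"
  assumes simple: "simple_function borel (\<psi> i)"
    and lim: "(\<lambda>i. \<psi> i x) \<longlonglongrightarrow> g x"
    and dom: "norm (\<psi> i x) \<le> 2 * norm (g x)"

lemma strongly_measurable_ex_simple_approximation:
  fixes f :: "real \<Rightarrow> 'a::banach"
  assumes S[measurable]: "S \<in> sets borel" and f: "strongly_measurable (lebesgue_on S) f"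
  obtains g \<psi> where "simple_approximation g \<psi>" "AE x in lborel. x \<in> S \<longrightarrow> f x = g x"
    "\<And>x. x \<notin> S \<Longrightarrow> g x = 0"
proof -
  obtain s where s: "\<And>i::nat. simple_function (lebesgue_on S) (s i)"
    and s_lim: "AE x in lborel. x \<in> S \<longrightarrow> (\<lambda>i. s i x) \<longlonglongrightarrow> f x"
    using f unfolding strongly_measurable_def AE_lebesgue_on_iff[OF S] by blast
  \<comment> \<open>Each Lebesgue simple function agrees almost everywhere with a Borel simple one.\<close>
  have "simple_function lebesgue (\<lambda>x. indicator S x *\<^sub>R s i x)" for i
    using s[of i] by (subst (asm) simple_function_restrict_space) auto
  then have "\<forall>i. \<exists>s'. simple_function lborel s' \<and> (AE x in lborel. indicator S x *\<^sub>R s i x = s' x)"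
    using completion_ex_simple_function by blast
  then obtain s' where s': "\<And>i. simple_function lborel (s' i)"
    and "\<And>i. AE x in lborel. indicator S x *\<^sub>R s i x = s' i x" by metis
  then have "AE x in lborel. \<forall>i. indicator S x *\<^sub>R s i x = s' i x"
    by (simp add: AE_all_countable)
  with s_lim have "AE x in lborel. x \<in> S \<longrightarrow> (\<lambda>i. s' i x) \<longlonglongrightarrow> f x"
  proof eventually_elim
    case (elim x)
    show ?case
    proof
      assume "x \<in> S"
      with elim have "s i x = s' i x" for i by (metis indicator_simps(1) scaleR_one)
      with elim \<open>x \<in> S\<close> show "(\<lambda>i. s' i x) \<longlonglongrightarrow> f x" by simp
    qed
  qed
  then obtain N where N: "N \<in> null_sets lborel"
    and N_lim: "\<And>x. x \<in> S - N \<Longrightarrow> (\<lambda>i. s' i x) \<longlonglongrightarrow> f x"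
    by (elim AE_E3) auto
  have [measurable]: "N \<in> sets borel" using N by (simp add: null_sets_def)
  \<comment> \<open>Deleting a Borel null set gives convergence everywhere; cutting off the values that are
    too large then gives the bound without changing the limit.\<close>
  define u where "u i x = (if x \<in> S - N then s' i x else 0)" for i x
  define g where "g x = (if x \<in> S - N then f x else 0)" for x
  define \<psi> where "\<psi> i x = (if norm (u i x) \<le> 2 * norm (g x) then u i x else 0)" for i x
  have s'_borel: "simple_function borel (s' i)" for i
    using s'[of i] by (simp add: simple_function_def)
  have u: "simple_function borel (u i)" for i
    unfolding u_def by (intro simple_function_If_set s'_borel simple_function_const) simp_all
  have u_lim: "(\<lambda>i. u i x) \<longlonglongrightarrow> g x" for x
    using N_lim[of x] by (auto simp: u_def g_def)
  have norm_u[measurable]: "(\<lambda>x. norm (u i x)) \<in> borel_measurable borel" for i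
    by (intro borel_measurable_simple_function simple_function_compose1[OF u])
  have norm_g[measurable]: "(\<lambda>x. norm (g x)) \<in> borel_measurable borel"
    by (rule borel_measurable_LIMSEQ_real[where u="\<lambda>i x. norm (u i x)"])
       (auto intro!: tendsto_norm u_lim)
  have "simple_approximation g \<psi>"
  proof
    show "simple_function borel (\<psi> i)" for i
      unfolding \<psi>_def by (intro simple_function_If u simple_function_const) measurable
    show "norm (\<psi> i x) \<le> 2 * norm (g x)" for i x by (simp add: \<psi>_def)
    show "(\<lambda>i. \<psi> i x) \<longlonglongrightarrow> g x" for x
    proof (cases "g x = 0")
      case True
      then have "\<psi> i x = 0" for i by (simp add: \<psi>_def)
      with True show ?thesis by simp
    next
      case False
      then have "eventually (\<lambda>i. norm (u i x) < 2 * norm (g x)) sequentially"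
        by (intro order_tendstoD[OF tendsto_norm[OF u_lim]]) simp
      then have "eventually (\<lambda>i. u i x = \<psi> i x) sequentially"
        by eventually_elim (simp add: \<psi>_def)
      with u_lim show ?thesis by (rule Lim_transform_eventually)
    qed
  qed
  moreover have "AE x in lborel. x \<in> S \<longrightarrow> f x = g x"
    using AE_not_in[OF N] by eventually_elim (simp add: g_def)
  moreover have "g x = 0" if "x \<notin> S" for x using that by (simp add: g_def)
  ultimately show thesis by (rule that)
qed

context simple_approximation
begin

lemma norm_diff_measurable [measurable (raw)]:
  assumes [measurable]: "a \<in> borel_measurable M" "b \<in> borel_measurable M"
  shows "(\<lambda>x. norm (g (a x) - g (b x))) \<in> borel_measurable M"
proof (rule borel_measurable_LIMSEQ_real)
  show "(\<lambda>x. norm (\<psi> i (a x) - \<psi> i (b x))) \<in> borel_measurable M" for i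
  proof (rule borel_measurable_simple_function)
    have "simple_function M (\<lambda>x. \<psi> i (c x))" if "c \<in> borel_measurable M" for c
      using that simple by (rule simple_function_comp)
    then show "simple_function M (\<lambda>x. norm (\<psi> i (a x) - \<psi> i (b x)))"
      by (intro simple_function_compose2[where h="\<lambda>x y. norm (x - y)"]) simp_all
  qed
  show "(\<lambda>i. norm (\<psi> i (a x) - \<psi> i (b x))) \<longlonglongrightarrow> norm (g (a x) - g (b x))" for x
    by (intro tendsto_intros lim)
qed

lemma norm_diff_const_measurable [measurable]:
  "(\<lambda>x. norm (g x - c)) \<in> borel_measurable borel"
proof (rule borel_measurable_LIMSEQ_real)
  show "(\<lambda>x. norm (\<psi> i x - c)) \<in> borel_measurable borel" for i
    by (intro borel_measurable_simple_function simple_function_compose1[OF simple])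
  show "(\<lambda>i. norm (\<psi> i x - c)) \<longlonglongrightarrow> norm (g x - c)" for x
    by (intro tendsto_intros lim)
qed

lemma norm_measurable [measurable]: "(\<lambda>x. norm (g x)) \<in> borel_measurable borel"
  using norm_diff_const_measurable[of 0] by simp

lemma simple_function_window:
  "simple_function (lebesgue_on {0..h}) (\<lambda>s. \<psi> i (t + s))"
  by (rule simple_function_comp[OF measurable_lebesgue_on simple]) simp

text \<open>
  Dominated convergence on the translated window \<open>{t..t + h}\<close> shows that the translates of the
  \<open>\<psi> i\<close> are \<open>L\<^sup>1\<close> approximations of \<open>f\<close> on \<open>{0..h}\<close>.
\<close>

lemma
  fixes f :: "real \<Rightarrow> 'a"
  assumes h: "0 < h"
    and fin: "(\<integral>\<^sup>+x\<in>{t..t+h}. norm (g x) \<partial>lborel) < \<infinity>"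
    and f: "AE s in lborel. s \<in> {0..h} \<longrightarrow> f s = g (t + s)"
  shows simple_bochner_integral_window_LIMSEQ:
      "(\<lambda>i. Bochner_Integration.simple_bochner_integral (lebesgue_on {0..h}) (\<lambda>s. \<psi> i (t + s)))
        \<longlonglongrightarrow> Bochner_int (lebesgue_on {0..h}) f" (is ?lim)
    and norm_const_diff_Bochner_int_window_le:
      "ennreal (norm (h *\<^sub>R c - Bochner_int (lebesgue_on {0..h}) f)) \<le>
        (\<integral>\<^sup>+s\<in>{0..h}. norm (g (t + s) - c) \<partial>lborel)" (is ?le)
proof -
  let ?M = "lebesgue_on {0..h}"
  interpret complete_measure ?M by (rule complete_measure_lebesgue_on) simp
  have AE_f: "AE s in ?M. f s = g (t + s)" using f by (simp add: AE_lebesgue_on_iff)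
  have [measurable]: "(\<lambda>s. norm (g (t + s) - c)) \<in> borel_measurable borel" for c
    by (rule measurable_compose[OF _ norm_diff_const_measurable]) simp
  have [measurable]: "(\<lambda>s. norm (g (t + s))) \<in> borel_measurable borel"
    by (rule measurable_compose[OF _ norm_measurable]) simp
  have "(\<integral>\<^sup>+s\<in>{0..h}. norm (g (t + s)) \<partial>lborel) =
      (\<integral>\<^sup>+s. ennreal (norm (g (t + s))) * indicator {t..t+h} (t + s) \<partial>lborel)"
    by (intro nn_integral_cong) (auto split: split_indicator)
  also have "\<dots> = (\<integral>\<^sup>+x\<in>{t..t+h}. norm (g x) \<partial>lborel)"
    by (rule nn_integral_lborel_translate) measurable
  finally have fin': "(\<integral>\<^sup>+s\<in>{0..h}. norm (g (t + s)) \<partial>lborel) < \<infinity>" using fin by simp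
  have sf: "strongly_measurable ?M f"
    unfolding strongly_measurable_def
  proof (intro exI[of _ "\<lambda>i s. \<psi> i (t + s)"] conjI allI simple_function_window)
    show "AE x in ?M. (\<lambda>i. \<psi> i (t + x)) \<longlonglongrightarrow> f x"
      using AE_f by eventually_elim (simp add: lim)
  qed
  have sbi: "Bochner_Integration.simple_bochner_integrable ?M (\<lambda>s. \<psi> i (t + s))" for i
  proof (rule Bochner_Integration.simple_bochner_integrableI_bounded)
    show "simple_function ?M (\<lambda>s. \<psi> i (t + s))" by (rule simple_function_window)
    have "(\<integral>\<^sup>+s. norm (\<psi> i (t + s)) \<partial>?M) = (\<integral>\<^sup>+s\<in>{0..h}. norm (\<psi> i (t + s)) \<partial>lborel)"
      by (simp add: nn_integral_lebesgue_on)
    also have "\<dots> \<le> (\<integral>\<^sup>+s. 2 * (ennreal (norm (g (t + s))) * indicator {0..h} s) \<partial>lborel)"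
      using dom[of i]
      by (intro nn_integral_mono)
         (auto split: split_indicator simp: ennreal_mult''[symmetric] simp flip: ennreal_numeral intro!: ennreal_leI)
    also have "\<dots> = 2 * (\<integral>\<^sup>+s\<in>{0..h}. norm (g (t + s)) \<partial>lborel)"
      by (rule nn_integral_cmult) measurable
    also have "\<dots> < \<infinity>" using fin' by (simp add: ennreal_mult_less_top)
    finally show "(\<integral>\<^sup>+s. norm (\<psi> i (t + s)) \<partial>?M) < \<infinity>" .
  qed
  have d_meas[measurable]: "(\<lambda>s. norm (g (t + s) - \<psi> i (t + s))) \<in> borel_measurable borel" for i
  proof (rule borel_measurable_LIMSEQ_real)
    show "(\<lambda>s. norm (\<psi> j (t + s) - \<psi> i (t + s))) \<in> borel_measurable borel" for j
    proof -
      have "simple_function borel (\<lambda>s. \<psi> k (t + s))" for k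
        by (rule simple_function_comp[OF _ simple]) simp
      then show ?thesis
        by (intro borel_measurable_simple_function
            simple_function_compose2[where h="\<lambda>x y. norm (x - y)"])
    qed
    show "(\<lambda>j. norm (\<psi> j (t + x) - \<psi> i (t + x))) \<longlonglongrightarrow> norm (g (t + x) - \<psi> i (t + x))" for x
      by (intro tendsto_intros lim)
  qed
  have "(\<lambda>i. \<integral>\<^sup>+s\<in>{0..h}. norm (g (t + s) - \<psi> i (t + s)) \<partial>lborel) \<longlonglongrightarrow> (\<integral>\<^sup>+s. 0 \<partial>(lborel :: real measure))"
  proof (rule nn_integral_dominated_convergence
      [where w="\<lambda>s. 3 * (ennreal (norm (g (t + s))) * indicator {0..h} s)"])
    show "AE s in lborel. ennreal (norm (g (t + s) - \<psi> i (t + s))) * indicator {0..h} s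
        \<le> 3 * (ennreal (norm (g (t + s))) * indicator {0..h} s)" for i
    proof (rule AE_I2)
      fix s
      have "norm (g (t + s) - \<psi> i (t + s)) \<le> 3 * norm (g (t + s))"
        using dom[of i "t + s"] norm_triangle_ineq4[of "g (t + s)" "\<psi> i (t + s)"] by linarith
      then have "ennreal (norm (g (t + s) - \<psi> i (t + s))) \<le> 3 * ennreal (norm (g (t + s)))"
        by (simp add: ennreal_mult''[symmetric] ennreal_leI flip: ennreal_numeral)
      then show "ennreal (norm (g (t + s) - \<psi> i (t + s))) * indicator {0..h} s
        \<le> 3 * (ennreal (norm (g (t + s))) * indicator {0..h} s)"
        by (auto split: split_indicator)
    qed
    have "(\<integral>\<^sup>+s. 3 * (ennreal (norm (g (t + s))) * indicator {0..h} s) \<partial>lborel) =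
        3 * (\<integral>\<^sup>+s\<in>{0..h}. norm (g (t + s)) \<partial>lborel)"
      by (rule nn_integral_cmult) measurable
    also have "\<dots> < \<infinity>" using fin' by (simp add: ennreal_mult_less_top)
    finally show "(\<integral>\<^sup>+s. 3 * (ennreal (norm (g (t + s))) * indicator {0..h} s) \<partial>lborel) < \<infinity>" .
    show "AE s in lborel. (\<lambda>i. ennreal (norm (g (t + s) - \<psi> i (t + s))) * indicator {0..h} s) \<longlonglongrightarrow> 0"
    proof (rule AE_I2)
      fix s
      have "(\<lambda>i. norm (g (t + s) - \<psi> i (t + s))) \<longlonglongrightarrow> norm (g (t + s) - g (t + s))"
        by (intro tendsto_intros lim)
      then have "(\<lambda>i. ennreal (norm (g (t + s) - \<psi> i (t + s)))) \<longlonglongrightarrow> ennreal 0"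
        by (intro tendsto_ennrealI) simp
      then show "(\<lambda>i. ennreal (norm (g (t + s) - \<psi> i (t + s))) * indicator {0..h} s) \<longlonglongrightarrow> 0"
        by (auto split: split_indicator)
    qed
  qed measurable
  moreover have "(\<integral>\<^sup>+s. norm (f s - \<psi> i (t + s)) \<partial>?M) =
      (\<integral>\<^sup>+s\<in>{0..h}. norm (g (t + s) - \<psi> i (t + s)) \<partial>lborel)" for i
    unfolding nn_integral_lebesgue_on[of "{0..h}", simplified, symmetric]
    by (intro nn_integral_cong_AE) (use AE_f in eventually_elim, simp)
  ultimately have conv: "(\<lambda>i. \<integral>\<^sup>+s. norm (f s - \<psi> i (t + s)) \<partial>?M) \<longlonglongrightarrow> 0"
    by simp
  show ?lim by (rule Bochner_int_LIMSEQ[OF sf sbi conv])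
  have "emeasure ?M (space ?M) = h" using h by (simp add: emeasure_restrict_space)
  moreover from this have "measure ?M (space ?M) = h" using h by (simp add: measure_def)
  ultimately have "ennreal (norm (h *\<^sub>R c - Bochner_int ?M f)) \<le> (\<integral>\<^sup>+s. norm (f s - c) \<partial>?M)"
    using norm_const_diff_Bochner_int_le[OF _ sf sbi conv, of c] by simp
  also have "\<dots> = (\<integral>\<^sup>+s. norm (g (t + s) - c) \<partial>?M)"
    by (intro nn_integral_cong_AE) (use AE_f in eventually_elim, simp)
  finally show ?le by (simp add: nn_integral_lebesgue_on)
qed

text \<open>
  The integral of a simple function over a moving window is a finite sum of vectors whose coefficients,
  the measures of the level sets inside the window, depend measurably on the position of the window.
  In the limit this gives the strong measurability of \<open>mean_op h \<phi>\<close>.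
\<close>

lemma strongly_measurable_window_integral:
  assumes S: "S \<in> sets lebesgue"
  shows "strongly_measurable (lebesgue_on S)
    (\<lambda>t. Bochner_Integration.simple_bochner_integral (lebesgue_on {0..h}) (\<lambda>s. \<psi> i (t + s)))"
proof -
  interpret complete_measure "lebesgue_on S" by (rule complete_measure_lebesgue_on[OF S])
  let ?m = "\<lambda>y t. measure lborel {s \<in> {0..h}. \<psi> i (t + s) = y}"
  have fin: "finite (range (\<psi> i))" using simple_functionD(1)[OF simple, of i] by simp
  have meas: "\<psi> i \<in> measurable borel (count_space UNIV)"
    by (rule measurable_simple_function[OF simple])
  have sets: "{z \<in> space (borel \<Otimes>\<^sub>M lborel). snd z \<in> {0..h} \<and> \<psi> i (fst z + snd z) = y}
      \<in> sets (borel \<Otimes>\<^sub>M lborel)" for y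
  proof -
    have [measurable]: "(\<lambda>z. \<psi> i (fst z + snd z)) \<in> measurable (borel \<Otimes>\<^sub>M lborel) (count_space UNIV)"
      by (rule measurable_compose[OF _ meas]) measurable
    show ?thesis by measurable
  qed
  have "(\<lambda>t. emeasure lborel (Pair t -`
      {z \<in> space (borel \<Otimes>\<^sub>M lborel). snd z \<in> {0..h} \<and> \<psi> i (fst z + snd z) = y}))
      \<in> borel_measurable borel" for y
    by (rule lborel.measurable_emeasure_Pair[OF sets])
  moreover have "Pair t -` {z \<in> space (borel \<Otimes>\<^sub>M lborel). snd z \<in> {0..h} \<and> \<psi> i (fst z + snd z) = y} =
      {s \<in> {0..h}. \<psi> i (t + s) = y}" for t y
    by (auto simp: space_pair_measure)
  ultimately have "(\<lambda>t. emeasure lborel {s \<in> {0..h}. \<psi> i (t + s) = y}) \<in> borel_measurable borel" for y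
    by simp
  then have m: "?m y \<in> borel_measurable borel" for y
    unfolding measure_def by (rule borel_measurable_enn2real)
  have m': "strongly_measurable (lebesgue_on S) (?m y)" for y
    unfolding strongly_measurable_iff_borel_measurable by (rule measurable_lebesgue_on[OF m])
  have eq: "Bochner_Integration.simple_bochner_integral (lebesgue_on {0..h}) (\<lambda>s. \<psi> i (t + s)) =
      (\<Sum>y\<in>range (\<psi> i). ?m y t *\<^sub>R y)" for t
  proof -
    have "measure (lebesgue_on {0..h}) {s \<in> {0..h}. \<psi> i (t + s) = y} = ?m y t" for y
    proof -
      have "(\<lambda>s. \<psi> i (t + s)) \<in> measurable borel (count_space UNIV)"
        by (rule measurable_compose[OF _ meas]) simp
      then have "{s \<in> {0..h}. \<psi> i (t + s) = y} \<in> sets lborel" by measurable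
      from measure_completion[OF this] show ?thesis
        by (subst measure_restrict_space) (auto simp del: measure_completion)
    qed
    then have "Bochner_Integration.simple_bochner_integral (lebesgue_on {0..h}) (\<lambda>s. \<psi> i (t + s)) =
      (\<Sum>y\<in>(\<lambda>s. \<psi> i (t + s)) ` {0..h}. ?m y t *\<^sub>R y)"
      by (simp add: Bochner_Integration.simple_bochner_integral_def)
    also have "\<dots> = (\<Sum>y\<in>range (\<psi> i). ?m y t *\<^sub>R y)"
    proof (rule sum.mono_neutral_left[OF fin])
      show "\<forall>y\<in>range (\<psi> i) - (\<lambda>s. \<psi> i (t + s)) ` {0..h}. ?m y t *\<^sub>R y = 0"
      proof
        fix y assume "y \<in> range (\<psi> i) - (\<lambda>s. \<psi> i (t + s)) ` {0..h}"
        then have "{s \<in> {0..h}. \<psi> i (t + s) = y} = {}" by blast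
        then show "?m y t *\<^sub>R y = 0" by (metis measure_empty scaleR_zero_left)
      qed
    qed auto
    finally show ?thesis .
  qed
  show ?thesis
    unfolding eq
    by (intro strongly_measurable_sum fin strongly_measurable_scaleR m' strongly_measurable_simple
        simple_function_const)
qed

end

section \<open>Uniform bounds from a covering argument\<close>

text \<open>
  This replaces the theorem of Steinhaus in the classical proof that subadditive measurable functions
  are locally bounded. For large \<open>N\<close> the part of \<open>{0<..2 * h}\<close> outside \<open>G N\<close> has measure less than
  \<open>h / 2\<close>. The points \<open>r\<close> of \<open>{0<..h}\<close> where \<open>r\<close> or \<open>r + s\<close> lies in that part have measure
  less than \<open>h\<close>, so a good \<open>r\<close> remains. The same \<open>N\<close> serves all \<open>s\<close> in \<open>{0<..h}\<close>, also those close
  to \<open>0\<close>.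
\<close>

lemma ex_uniform_common_translate:
  fixes G :: "nat \<Rightarrow> real set"
  assumes meas: "\<And>n. G n \<in> sets borel" and inc: "incseq G"
    and cover: "\<And>s. 0 < s \<Longrightarrow> \<exists>n. s \<in> G n" and h: "0 < h"
  obtains N where "\<And>s. 0 < s \<Longrightarrow> s \<le> h \<Longrightarrow> \<exists>r>0. r \<in> G N \<and> r + s \<in> G N"
proof -
  define B where "B n = {0<..2 * h} - G n" for n
  have B_meas[measurable]: "B n \<in> sets borel" for n using meas by (simp add: B_def)
  have "decseq B" using inc by (auto simp: B_def decseq_def incseq_def)
  moreover have "range B \<subseteq> sets lborel" using B_meas by auto
  moreover have "(\<Inter>n. B n) = {}" using cover by (auto simp: B_def)
  moreover have "emeasure lborel (B n) \<noteq> \<infinity>" for n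
  proof -
    have "emeasure lborel (B n) \<le> emeasure lborel {0<..2 * h}"
      by (rule emeasure_mono) (auto simp: B_def)
    then show ?thesis using h by (auto simp: top_unique)
  qed
  ultimately have "(\<lambda>n. emeasure lborel (B n)) \<longlonglongrightarrow> 0"
    using Lim_emeasure_decseq[of B lborel] by simp
  then have "eventually (\<lambda>n. emeasure lborel (B n) < ennreal (h / 2)) sequentially"
    by (rule order_tendstoD) (use h in simp)
  then obtain N where N: "emeasure lborel (B N) < ennreal (h / 2)"
    by (auto simp: eventually_sequentially)
  show thesis
  proof (rule that[of N], rule ccontr)
    fix s assume s: "0 < s" "s \<le> h" and no: "\<not> (\<exists>r>0. r \<in> G N \<and> r + s \<in> G N)"
    let ?B' = "{r. s + r \<in> B N}"
    have [measurable]: "?B' \<in> sets borel" by measurable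
    have "emeasure lborel ?B' = (\<integral>\<^sup>+r. indicator ?B' r \<partial>lborel)" by simp
    also have "\<dots> = (\<integral>\<^sup>+r. indicator (B N) (s + r) \<partial>lborel)"
      by (intro nn_integral_cong) (simp add: indicator_def)
    also have "\<dots> = emeasure lborel (B N)"
      by (subst nn_integral_lborel_translate) auto
    finally have eq: "emeasure lborel ?B' = emeasure lborel (B N)" .
    have "{0<..h} \<subseteq> B N \<union> ?B'"
      using no s by (auto simp: B_def add.commute)
    then have "emeasure lborel {0<..h} \<le> emeasure lborel (B N \<union> ?B')"
      by (intro emeasure_mono) auto
    also have "\<dots> \<le> emeasure lborel (B N) + emeasure lborel ?B'"
      by (intro emeasure_subadditive) auto
    also have "\<dots> < ennreal (h / 2) + ennreal (h / 2)"
      unfolding eq using N by (intro add_strict_mono)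
    also have "\<dots> = ennreal h" using h by (simp flip: ennreal_plus)
    finally show False using h by simp
  qed
qed

section \<open>Power inequalities\<close>

text \<open>
  Young's inequality for the conjugate exponents \<open>p\<close> and \<open>p / (p - 1)\<close>, multiplied by \<open>p\<close>; equivalently,
  the graph of \<open>a powr p\<close> lies above its tangent at \<open>b\<close>. In this form it also covers \<open>p = 1\<close>.
\<close>

lemma powr_Youngs_inequality:
  fixes a b p :: real
  assumes "1 \<le> p" "0 \<le> a" "0 \<le> b"
  shows "p * b powr (p - 1) * a \<le> a powr p + (p - 1) * b powr p"
proof (cases "p = 1")
  case True
  then show ?thesis using assms by auto
next
  case False
  then have p: "1 < p" using assms by simp
  have "a * b powr (p - 1) \<le> a powr p / p + (b powr (p - 1)) powr (p / (p - 1)) / (p / (p - 1))"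
    using p assms by (intro Youngs_inequality) (auto simp: field_simps)
  also have "(b powr (p - 1)) powr (p / (p - 1)) = b powr p"
    using p by (simp add: powr_powr)
  finally have "p * (a * b powr (p - 1)) \<le> p * (a powr p / p + b powr p / (p / (p - 1)))"
    using p by (intro mult_left_mono) auto
  also have "\<dots> = a powr p + (p - 1) * b powr p" using p by (simp add: field_simps)
  finally show ?thesis by (simp add: mult_ac)
qed

text \<open>
  Jensen's inequality for the power \<open>p\<close>, for a number \<open>e\<close> that is at most the mean of \<open>d\<close>. It is proved
  by integrating the tangent inequality at the point \<open>e\<close> itself, so the integral on the right may be
  infinite.
\<close>

lemma nn_integral_powr_mean_ge:
  fixes d :: "'a \<Rightarrow> real"
  assumes [measurable]: "d \<in> borel_measurable M" and d: "\<And>x. 0 \<le> d x"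
    and p: "1 \<le> p" and e: "0 \<le> e" and h: "0 < h" "emeasure M (space M) = ennreal h"
    and mean: "ennreal (h * e) \<le> (\<integral>\<^sup>+x. d x \<partial>M)"
  shows "ennreal (h * e powr p) \<le> (\<integral>\<^sup>+x. d x powr p \<partial>M)"
proof -
  have "h * e powr p + (p - 1) * e powr p * h = p * h * e powr p" by (simp add: algebra_simps)
  also have "\<dots> = p * e powr (p - 1) * (h * e)"
    using powr_mult_base[OF e, of "p - 1"] by (simp add: mult_ac)
  finally have "ennreal (h * e powr p) + ennreal ((p - 1) * e powr p * h) =
      ennreal (p * e powr (p - 1)) * ennreal (h * e)"
    using e p h by (simp flip: ennreal_plus ennreal_mult)
  also have "\<dots> \<le> ennreal (p * e powr (p - 1)) * (\<integral>\<^sup>+x. d x \<partial>M)"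
    by (intro mult_left_mono mean) simp
  also have "\<dots> = (\<integral>\<^sup>+x. ennreal (p * e powr (p - 1) * d x) \<partial>M)"
    using p by (subst nn_integral_cmult[symmetric]) (auto simp: ennreal_mult' mult.assoc)
  also have "\<dots> \<le> (\<integral>\<^sup>+x. ennreal (d x powr p) + ennreal ((p - 1) * e powr p) \<partial>M)"
    using powr_Youngs_inequality[OF p d e] p
    by (intro nn_integral_mono) (simp add: ennreal_leI flip: ennreal_plus)
  also have "\<dots> = (\<integral>\<^sup>+x. d x powr p \<partial>M) + ennreal ((p - 1) * e powr p * h)"
    using p h by (subst nn_integral_add) (auto simp: ennreal_mult)
  finally show ?thesis
    by (simp add: add.commute[of _ "ennreal ((p - 1) * e powr p * h)"] ennreal_add_left_cancel_le)
qed

lemma powr_add_le: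
  fixes a b p :: real
  assumes "0 \<le> a" "0 \<le> b" "0 \<le> p"
  shows "(a + b) powr p \<le> 2 powr p * (a powr p + b powr p)"
proof -
  have "(a + b) powr p \<le> (2 * max a b) powr p"
    using assms by (intro powr_mono2) auto
  also have "\<dots> = 2 powr p * max a b powr p" using assms by (simp add: powr_mult)
  also have "\<dots> \<le> 2 powr p * (a powr p + b powr p)"
    by (intro mult_left_mono) (auto simp: max_def)
  finally show ?thesis .
qed

section \<open>Weights\<close>

text \<open>
  Translations by more than \<open>1\<close> are composed of steps of length at most \<open>1\<close>; each step multiplies the
  constant, so the constant depends on \<open>h\<close> but not on \<open>s\<close>.
\<close>

lemma AE_weight_le_translate:
  fixes w :: "real \<Rightarrow> real"
  assumes J: "\<And>t s. t \<in> J \<Longrightarrow> 0 \<le> s \<Longrightarrow> t + s \<in> J"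
    and nonneg: "\<And>t. t \<in> J \<Longrightarrow> 0 \<le> w t"
    and w: "\<And>s. 0 < s \<Longrightarrow> s \<le> 1 \<Longrightarrow> AE t in lborel. t \<in> J \<longrightarrow> w t \<le> c * w (t + s)"
  obtains C where "0 \<le> C"
    "\<And>s. 0 < s \<Longrightarrow> s \<le> h \<Longrightarrow> AE t in lborel. t \<in> J \<longrightarrow> w t \<le> C * w (t + s)"
proof -
  \<comment> \<open>A negative \<open>c\<close> would spoil the monotonicity of multiplication by it.\<close>
  define k where "k = max 0 c"
  have k: "AE t in lborel. t \<in> J \<longrightarrow> w t \<le> k * w (t + s)" if "0 < s" "s \<le> 1" for s
    using w[OF that]
  proof eventually_elim
    case (elim t)
    have "c * w (t + s) \<le> k * w (t + s)" if "t \<in> J"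
      using nonneg[OF J[OF that, of s]] \<open>0 < s\<close> by (intro mult_right_mono) (auto simp: k_def)
    with elim show ?case by force
  qed
  have iter: "\<exists>C\<ge>0. \<forall>s. 0 < s \<and> s \<le> real (Suc n) \<longrightarrow>
      (AE t in lborel. t \<in> J \<longrightarrow> w t \<le> C * w (t + s))" for n
  proof (induction n)
    case 0
    show ?case using k by (intro exI[of _ k]) (auto simp: k_def)
  next
    case (Suc n)
    then obtain C where C: "0 \<le> C" "\<And>s. 0 < s \<Longrightarrow> s \<le> real (Suc n) \<Longrightarrow>
      AE t in lborel. t \<in> J \<longrightarrow> w t \<le> C * w (t + s)" by blast
    have "AE t in lborel. t \<in> J \<longrightarrow> w t \<le> (max k (k * C)) * w (t + s)"
      if s: "0 < s" "s \<le> real (Suc (Suc n))" for s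
    proof (cases "s \<le> 1")
      case True
      from k[OF s(1) this] show ?thesis
      proof eventually_elim
        case (elim t)
        have "k * w (t + s) \<le> (max k (k * C)) * w (t + s)" if "t \<in> J"
          using nonneg[OF J[OF that, of s]] s by (intro mult_right_mono) auto
        with elim show ?case by force
      qed
    next
      case False
      then have "AE t in lborel. t \<in> J \<longrightarrow> w t \<le> C * w (t + (s - 1))"
        using s by (intro C(2)) auto
      from AE_lborel_translate[OF this, of 1] k[of 1, simplified] show ?thesis
      proof eventually_elim
        case (elim t)
        show ?case
        proof
          assume t: "t \<in> J"
          have "w t \<le> k * w (t + 1)" using elim t by simp
          also have "\<dots> \<le> k * (C * w (t + s))"
            using elim(1) J[OF t, of 1] by (intro mult_left_mono) (auto simp: k_def add.commute)
          also have "\<dots> \<le> (max k (k * C)) * w (t + s)"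
            using nonneg[OF J[OF t, of s]] s mult_right_mono[of "k * C" "max k (k * C)" "w (t + s)"]
            by simp
          finally show "w t \<le> (max k (k * C)) * w (t + s)" .
        qed
      qed
    qed
    moreover have "0 \<le> max k (k * C)" by (simp add: k_def)
    ultimately show ?case by blast
  qed
  obtain n where "h \<le> real n" using real_arch_simple by blast
  then have n: "h \<le> real (Suc n)" by simp
  obtain C where "0 \<le> C" "\<forall>s. 0 < s \<and> s \<le> real (Suc n) \<longrightarrow>
      (AE t in lborel. t \<in> J \<longrightarrow> w t \<le> C * w (t + s))" using iter[of n] by blast
  with n show thesis by (intro that[of C]) auto
qed

section \<open>Uniform bounds for increments\<close>

context simple_approximation
begin

text \<open>
  The identity \<open>\<Delta>\<^sub>s g (x) = \<Delta>\<^bsub>r + s\<^esub> g (x) - \<Delta>\<^sub>r g (x + s)\<close>: an increment over a possibly small step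
  \<open>s\<close> is controlled by two increments over steps that may be chosen freely. It only looks to the right
  of \<open>x\<close>, and so it holds up to the left end of a half-line.
\<close>

lemma increment_le:
  "norm (g (x + s) - g x) \<le> norm (g (x + (r + s)) - g x) + norm (g (s + x + r) - g (s + x))"
  using norm_triangle_ineq4[of "g (x + (r + s)) - g x" "g (s + x + r) - g (s + x)"]
  by (simp add: algebra_simps)

text \<open>
  The function \<open>F\<close> below, the \<open>p\<close>-th power of the weighted norm of the increment, satisfies
  \<open>F s \<le> const * (F (r + s) + C * F r)\<close> by the preceding identity, since a translation by \<open>s\<close> costs
  at most the factor \<open>C\<close> of the weight. Some \<open>N\<close> admits, for every \<open>s\<close> in \<open>{0<..h}\<close>, an \<open>r\<close> with
  both values on the right at most \<open>N\<close>.
\<close>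

lemma weighted_increment_integral_bounded:
  assumes [measurable]: "v \<in> borel_measurable borel" and v: "\<And>x. 0 \<le> v x"
    and C: "0 \<le> C" "\<And>s. 0 < s \<Longrightarrow> s \<le> h \<Longrightarrow> AE x in lborel. v x \<le> C * v (x + s)"
    and h: "0 < h" and p: "0 \<le> p"
    and fin: "\<And>s. 0 < s \<Longrightarrow> (\<integral>\<^sup>+x. v x * norm (g (x + s) - g x) powr p \<partial>lborel) < \<infinity>"
  obtains K where "\<And>s. 0 < s \<Longrightarrow> s \<le> h \<Longrightarrow>
    (\<integral>\<^sup>+x. v x * norm (g (x + s) - g x) powr p \<partial>lborel) \<le> ennreal K"
proof -
  define F where "F s = (\<integral>\<^sup>+x. v x * norm (g (x + s) - g x) powr p \<partial>lborel)" for s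
  have [measurable]: "F \<in> borel_measurable borel" unfolding F_def by measurable
  define G where "G n = {s. 0 < s \<and> F s \<le> of_nat n}" for n :: nat
  obtain N where N: "\<And>s. 0 < s \<Longrightarrow> s \<le> h \<Longrightarrow> \<exists>r>0. r \<in> G N \<and> r + s \<in> G N"
  proof (rule ex_uniform_common_translate[of G h])
    show "G n \<in> sets borel" for n unfolding G_def by measurable
    show "incseq G"
      by (auto simp: G_def incseq_def elim!: order_trans)
    show "\<exists>n. s \<in> G n" if "0 < s" for s
    proof -
      have "F s < top" using fin[OF that] by (simp add: F_def)
      then obtain n where "F s < of_nat n" using ennreal_Ex_less_of_nat[of "F s"] by auto
      then show ?thesis using that by (auto simp: G_def intro: less_imp_le)
    qed
  qed (use h in auto)
  show thesis
  proof (rule that[of "2 powr p * (real N + C * real N)"])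
    fix s assume s: "0 < s" "s \<le> h"
    obtain r where r: "F r \<le> of_nat N" "F (r + s) \<le> of_nat N" using N[OF s] by (auto simp: G_def)
    let ?d = "\<lambda>s x. norm (g (x + s) - g x) powr p"
    have "F s \<le> (\<integral>\<^sup>+x. ennreal (2 powr p) * (ennreal (v x * ?d (r + s) x) + ennreal C * ennreal (v (s + x) * ?d r (s + x))) \<partial>lborel)"
      unfolding F_def
    proof (rule nn_integral_mono_AE)
      show "AE x in lborel. ennreal (v x * ?d s x) \<le>
        ennreal (2 powr p) * (ennreal (v x * ?d (r + s) x) + ennreal C * ennreal (v (s + x) * ?d r (s + x)))"
        using C(2)[OF s]
      proof eventually_elim
        case (elim x)
        have "?d s x \<le> (norm (g (x + (r + s)) - g x) + norm (g (s + x + r) - g (s + x))) powr p"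
          using p by (intro powr_mono2 increment_le) auto
        also have "\<dots> \<le> 2 powr p * (?d (r + s) x + ?d r (s + x))"
          using p by (intro powr_add_le) auto
        finally have "v x * ?d s x \<le> v x * (2 powr p * (?d (r + s) x + ?d r (s + x)))"
          using v by (intro mult_left_mono)
        also have "\<dots> = 2 powr p * (v x * ?d (r + s) x + v x * ?d r (s + x))"
          by (simp add: algebra_simps)
        also have "\<dots> \<le> 2 powr p * (v x * ?d (r + s) x + (C * v (s + x)) * ?d r (s + x))"
          using elim by (intro mult_left_mono add_left_mono mult_right_mono) (auto simp: add.commute)
        finally show ?case
          using v C by (simp add: mult.assoc ennreal_leI flip: ennreal_plus ennreal_mult)
      qed
    qed
    also have "\<dots> = ennreal (2 powr p) * (F (r + s) + ennreal C * (\<integral>\<^sup>+x. ennreal (v (s + x) * ?d r (s + x)) \<partial>lborel))"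
      unfolding F_def by (simp add: nn_integral_cmult nn_integral_add)
    also have "(\<integral>\<^sup>+x. ennreal (v (s + x) * ?d r (s + x)) \<partial>lborel) = F r"
      unfolding F_def by (rule nn_integral_lborel_translate) measurable
    also have "ennreal (2 powr p) * (F (r + s) + ennreal C * F r) \<le>
        ennreal (2 powr p) * (of_nat N + ennreal C * of_nat N)"
      using r by (intro mult_left_mono add_mono) auto
    also have "\<dots> = ennreal (2 powr p * (real N + C * real N))"
      using C by (simp add: ennreal_of_nat_eq_real_of_nat flip: ennreal_plus ennreal_mult)
    finally show "(\<integral>\<^sup>+x. v x * ?d s x \<partial>lborel) \<le> ennreal (2 powr p * (real N + C * real N))"
      by (simp add: F_def)
  qed
qed

text \<open>
  The analogue for \<open>p = \<infinity>\<close>. The sublevel sets of the essential supremum are measurable in \<open>s\<close>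
  because an essential bound \<open>n\<close> means that the integral of the excess over \<open>n\<close> vanishes.
\<close>

lemma weighted_increment_essentially_bounded:
  assumes [measurable]: "v \<in> borel_measurable borel" and v: "\<And>x. 0 \<le> v x"
    and C: "0 \<le> C" "\<And>s. 0 < s \<Longrightarrow> s \<le> h \<Longrightarrow> AE x in lborel. v x \<le> C * v (x + s)"
    and h: "0 < h"
    and bdd: "\<And>s. 0 < s \<Longrightarrow> \<exists>B. AE x in lborel. v x * norm (g (x + s) - g x) \<le> B"
  obtains K where "\<And>s. 0 < s \<Longrightarrow> s \<le> h \<Longrightarrow> AE x in lborel. v x * norm (g (x + s) - g x) \<le> K"
proof -
  define F where "F n s = (\<integral>\<^sup>+x. ennreal (v x * norm (g (x + s) - g x) - real n) \<partial>lborel)" for n :: nat and s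
  have [measurable]: "F n \<in> borel_measurable borel" for n unfolding F_def by measurable
  have F_iff: "F n s = 0 \<longleftrightarrow> (AE x in lborel. v x * norm (g (x + s) - g x) \<le> real n)" for n s
    unfolding F_def by (subst nn_integral_0_iff_AE) (auto simp: ennreal_eq_0_iff)
  define G where "G n = {s. 0 < s \<and> F n s = 0}" for n :: nat
  obtain N where N: "\<And>s. 0 < s \<Longrightarrow> s \<le> h \<Longrightarrow> \<exists>r>0. r \<in> G N \<and> r + s \<in> G N"
  proof (rule ex_uniform_common_translate[of G h])
    show "G n \<in> sets borel" for n unfolding G_def by measurable
    show "incseq G"
      unfolding incseq_def
    proof (intro allI impI subsetI)
      fix m n s assume "m \<le> n" "s \<in> G m"
      then have "AE x in lborel. v x * norm (g (x + s) - g x) \<le> real m" "0 < s"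
        by (auto simp: G_def F_iff)
      moreover from this(1) have "AE x in lborel. v x * norm (g (x + s) - g x) \<le> real n"
        by eventually_elim (use \<open>m \<le> n\<close> in auto)
      ultimately show "s \<in> G n" by (auto simp: G_def F_iff)
    qed
    show "\<exists>n. s \<in> G n" if "0 < s" for s
    proof -
      from bdd[OF that] obtain B where B: "AE x in lborel. v x * norm (g (x + s) - g x) \<le> B" ..
      obtain n where "B \<le> real n" using real_arch_simple by blast
      with B have "AE x in lborel. v x * norm (g (x + s) - g x) \<le> real n" by auto
      then show ?thesis using \<open>0 < s\<close> by (auto simp: G_def F_iff)
    qed
  qed (use h in auto)
  show thesis
  proof (rule that[of "real N + C * real N"])
    fix s assume s: "0 < s" "s \<le> h"
    obtain r where r: "AE x in lborel. v x * norm (g (x + r) - g x) \<le> real N"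
      "AE x in lborel. v x * norm (g (x + (r + s)) - g x) \<le> real N"
      using N[OF s] by (auto simp: G_def F_iff)
    from AE_lborel_translate[OF r(1), of s] r(2) C(2)[OF s]
    show "AE x in lborel. v x * norm (g (x + s) - g x) \<le> real N + C * real N"
    proof eventually_elim
      case (elim x)
      let ?a = "norm (g (x + (r + s)) - g x)" and ?b = "norm (g (s + x + r) - g (s + x))"
      have "v x * norm (g (x + s) - g x) \<le> v x * (?a + ?b)"
        using v by (intro mult_left_mono increment_le)
      also have "\<dots> = v x * ?a + v x * ?b" by (rule distrib_left)
      also have "v x * ?b \<le> C * v (s + x) * ?b"
        using elim(3) by (intro mult_right_mono) (auto simp: add.commute)
      also have "\<dots> \<le> C * real N"
        using elim(1) C(1) by (simp add: mult.assoc mult_left_mono)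
      finally show ?case using elim(2) by simp
    qed
  qed
qed

end

section \<open>The deviation from the mean\<close>

theorem proposition4p9:
  fixes J :: "real set" and p :: ennreal and w :: "real \<Rightarrow> real"
  assumes "J = UNIV \<or> (\<exists>\<alpha>. J = {\<alpha><..}) \<or> (\<exists>\<alpha>. J = {\<alpha>..})"
    and "1 \<le> p"
    and "w \<in> borel_measurable (lebesgue_on J)"
    and "\<And>t. t \<in> J \<Longrightarrow> 0 \<le> w t"
    and "\<exists>c::real. \<forall>h. 0 < h \<and> h \<le> 1 \<longrightarrow>
           (AE t in lebesgue_on J. w (t + h) \<le> c * w t \<and> w t \<le> c * w (t + h))"
  shows "satisfies_Delta J (Lp_w p w J :: (real \<Rightarrow> 'a::banach) set)"
  unfolding satisfies_Delta_def
proof (intro ballI impI allI)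
  fix \<phi> :: "real \<Rightarrow> 'a" and h :: real
  assume \<phi>: "\<phi> \<in> L1_loc J" and \<Delta>: "\<forall>s>0. diff_op s \<phi> \<in> Lp_w p w J" and h: "0 < h"
  have J[measurable]: "J \<in> sets borel" using assms(1) by auto
  have up: "t + s \<in> J" if "t \<in> J" "0 \<le> s" for t s using assms(1) that by auto
  have window: "{t..t + h} \<subseteq> J" if "t \<in> J" for t
    using up[OF that, of "x - t" for x] by force
  note AE_J = AE_lebesgue_on_iff[OF J]
  interpret J: complete_measure "lebesgue_on J"
    by (rule complete_measure_lebesgue_on) (use J in simp)

  \<comment> \<open>A Borel version of the weight, extended by \<open>0\<close>; the extension lets all integrals over \<open>J\<close>
    be taken over the whole line.\<close>
  obtain v where v_meas[measurable]: "v \<in> borel_measurable borel" and v: "\<And>x. 0 \<le> v x"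
    and v_off: "\<And>x. x \<notin> J \<Longrightarrow> v x = 0" and wv: "AE x in lborel. x \<in> J \<longrightarrow> w x = v x"
  proof -
    have "(\<lambda>x. if x \<in> J then w x else 0) \<in> borel_measurable lebesgue"
      using assms(3) J by (intro borel_measurable_if_I) simp_all
    then obtain v where v: "v \<in> borel_measurable lborel"
      "AE x in lborel. (if x \<in> J then w x else 0) = v x"
      using completion_ex_borel_measurable_real by blast
    then have [measurable]: "v \<in> borel_measurable borel" by simp
    show thesis
    proof (rule that[of "\<lambda>x. max 0 (v x) * indicator J x"])
      show "AE x in lborel. x \<in> J \<longrightarrow> w x = max 0 (v x) * indicator J x"
        using v(2)
      proof eventually_elim
        case (elim x)
        then show ?case using assms(4)[of x] by auto
      qed
    qed auto
  qed

  obtain C where C: "0 \<le> C" "\<And>s. 0 < s \<Longrightarrow> s \<le> h \<Longrightarrow> AE x in lborel. v x \<le> C * v (x + s)"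
  proof -
    obtain c where c: "\<forall>s. 0 < s \<and> s \<le> 1 \<longrightarrow>
        (AE t in lborel. t \<in> J \<longrightarrow> w (t + s) \<le> c * w t \<and> w t \<le> c * w (t + s))"
      using assms(5) unfolding AE_J by (elim exE)
    have "AE t in lborel. t \<in> J \<longrightarrow> w t \<le> c * w (t + s)" if "0 < s" "s \<le> 1" for s
    proof -
      have "AE t in lborel. t \<in> J \<longrightarrow> w (t + s) \<le> c * w t \<and> w t \<le> c * w (t + s)"
        using c that by simp
      then show ?thesis by eventually_elim simp
    qed
    from AE_weight_le_translate[of J w c h, OF up assms(4) this]
    obtain C where C: "0 \<le> C"
      "\<And>s. 0 < s \<Longrightarrow> s \<le> h \<Longrightarrow> AE t in lborel. t \<in> J \<longrightarrow> w t \<le> C * w (t + s)"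
      by blast
    show thesis
    proof (rule that[OF C(1)])
      fix s assume s: "0 < s" "s \<le> h"
      from C(2)[OF s] wv AE_lborel_translate[OF wv, of s]
      show "AE x in lborel. v x \<le> C * v (x + s)"
      proof eventually_elim
        case (elim x)
        show ?case
        proof (cases "x \<in> J")
          case True
          then have "x + s \<in> J" using up s by simp
          then show ?thesis using elim True by (simp add: add.commute)
        qed (use v v_off C in auto)
      qed
    qed
  qed

  have \<phi>_meas: "strongly_measurable (lebesgue_on J) \<phi>"
    and \<phi>_loc: "\<And>K. compact K \<Longrightarrow> K \<subseteq> J \<Longrightarrow> Bochner_integrable (lebesgue_on K) \<phi>"
    using \<phi> by (auto simp: L1_loc_def)
  obtain g \<psi> where "simple_approximation g \<psi>" and g: "AE x in lborel. x \<in> J \<longrightarrow> \<phi> x = g x"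
    by (rule strongly_measurable_ex_simple_approximation[OF J \<phi>_meas])
  then interpret simple_approximation g \<psi> by simp

  have \<phi>_translate: "AE x in lborel. x \<in> J \<longrightarrow> \<phi> (x + s) = g (x + s)" if "0 \<le> s" for s
    using AE_lborel_translate[OF g, of s]
    by eventually_elim (use up that in \<open>auto simp: add.commute\<close>)
  have fin: "(\<integral>\<^sup>+x\<in>{t..t+h}. norm (g x) \<partial>lborel) < \<infinity>" if t: "t \<in> J" for t
  proof -
    have "(\<integral>\<^sup>+x\<in>{t..t+h}. norm (g x) \<partial>lborel) = (\<integral>\<^sup>+x\<in>{t..t+h}. norm (\<phi> x) \<partial>lborel)"
      by (intro nn_integral_cong_AE)
         (use g in eventually_elim, use window[OF t] in \<open>auto split: split_indicator\<close>)
    also have "\<dots> = (\<integral>\<^sup>+x. norm (\<phi> x) \<partial>lebesgue_on {t..t+h})"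
      by (simp add: nn_integral_lebesgue_on)
    also have "\<dots> < \<infinity>"
      by (intro Bochner_integrable_imp_nn_integral_finite complete_measure_lebesgue_on \<phi>_loc window t)
         auto
    finally show ?thesis .
  qed
  have \<phi>_window: "AE s in lborel. s \<in> {0..h} \<longrightarrow> \<phi> (t + s) = g (t + s)" if t: "t \<in> J" for t
    using AE_lborel_translate[OF g, of t] by eventually_elim (use up[OF t] in auto)

  let ?I = "\<lambda>t. Bochner_int (lebesgue_on {0..h}) (\<lambda>s. \<phi> (t + s))"
  define e where "e t = norm (\<phi> t - mean_op h \<phi> t)" for t
  have I_meas: "strongly_measurable (lebesgue_on J) ?I"
  proof (rule J.strongly_measurable_LIMSEQ)
    show "strongly_measurable (lebesgue_on J)
        (\<lambda>t. Bochner_Integration.simple_bochner_integral (lebesgue_on {0..h}) (\<lambda>s. \<psi> i (t + s)))" for i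
      by (rule strongly_measurable_window_integral) (use J in simp)
    show "AE t in lebesgue_on J.
        (\<lambda>i. Bochner_Integration.simple_bochner_integral (lebesgue_on {0..h}) (\<lambda>s. \<psi> i (t + s))) \<longlonglongrightarrow> ?I t"
      by (rule AE_I2) (use simple_bochner_integral_window_LIMSEQ[OF h fin \<phi>_window] in simp)
  qed
  have dev_meas: "strongly_measurable (lebesgue_on J) (\<lambda>t. \<phi> t - mean_op h \<phi> t)"
    unfolding mean_op_def
    by (intro strongly_measurable_diff strongly_measurable_scaleR \<phi>_meas I_meas
        strongly_measurable_simple[of _ "\<lambda>_. 1 / h"]) simp
  have e_meas[measurable]: "e \<in> borel_measurable (lebesgue_on J)"
    using J.borel_measurable_norm_diff_strongly[OF dev_meas, of "\<lambda>_. 0"]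
    by (simp add: e_def[abs_def] strongly_measurable_simple)
  note w_meas[measurable] = assms(3)

  have e_le: "ennreal (h * e t) \<le> (\<integral>\<^sup>+s. norm (g (t + s) - g t) \<partial>lebesgue_on {0..h})"
    if t: "t \<in> J" "\<phi> t = g t" for t
  proof -
    have "h *\<^sub>R g t - ?I t = h *\<^sub>R (\<phi> t - mean_op h \<phi> t)"
      using t h by (simp add: mean_op_def scaleR_diff_right)
    then have "h * e t = norm (h *\<^sub>R g t - ?I t)" using h by (simp add: e_def)
    with norm_const_diff_Bochner_int_window_le[OF h fin[OF t(1)] \<phi>_window[OF t(1)], of "g t"]
    show ?thesis by (simp add: nn_integral_lebesgue_on)
  qed
  have increment: "AE x in lborel. x \<in> J \<longrightarrow> w x = v x \<and> diff_op s \<phi> x = g (x + s) - g x"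
    if "0 < s" for s
    using wv g \<phi>_translate[OF less_imp_le[OF that]] by eventually_elim (auto simp: diff_op_def)

  show "(\<lambda>t. \<phi> t - mean_op h \<phi> t) \<in> Lp_w p w J"
  proof (cases "p = \<infinity>")
    case True
    have "\<exists>B. AE x in lborel. v x * norm (g (x + s) - g x) \<le> B" if s: "0 < s" for s
    proof -
      obtain B where B: "AE t in lborel. t \<in> J \<longrightarrow> \<bar>w t * norm (diff_op s \<phi> t)\<bar> \<le> B"
        using \<Delta> s True unfolding Lp_w_def AE_J by auto
      have "AE x in lborel. v x * norm (g (x + s) - g x) \<le> max B 0"
        using B increment[OF s]
      proof eventually_elim
        case (elim x)
        then show ?case using v_off[of x] by (cases "x \<in> J") auto
      qed
      then show ?thesis ..
    qed
    then obtain K0 where K0: "\<And>s. 0 < s \<Longrightarrow> s \<le> h \<Longrightarrow>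
        AE x in lborel. v x * norm (g (x + s) - g x) \<le> K0"
      using weighted_increment_essentially_bounded[OF v_meas v C h] by blast
    \<comment> \<open>Nonnegativity takes care of \<open>s = 0\<close>, where the increment vanishes.\<close>
    define K where "K = max K0 0"
    have "AE x in lborel. s \<in> {0..h} \<longrightarrow> v x * norm (g (x + s) - g x) \<le> K" for s
    proof (cases "0 < s \<and> s \<le> h")
      case True
      with K0[of s] have "AE x in lborel. v x * norm (g (x + s) - g x) \<le> K0" by simp
      then show ?thesis by eventually_elim (auto simp: K_def)
    next
      case False
      then have "s \<in> {0..h} \<Longrightarrow> s = 0" by auto
      then show ?thesis by (auto simp: K_def)
    qed
    then have "AE s in lborel. AE x in lborel. s \<in> {0..h} \<longrightarrow> v x * norm (g (x + s) - g x) \<le> K"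
      by simp
    \<comment> \<open>Fubini: for almost every \<open>x\<close> the bound holds for almost every \<open>s\<close> and can be averaged.\<close>
    then have "AE x in lborel. AE s in lborel. s \<in> {0..h} \<longrightarrow> v x * norm (g (x + s) - g x) \<le> K"
      by (subst lborel_pair.AE_commute) measurable
    then have "AE x in lborel. x \<in> J \<longrightarrow> \<bar>w x * e x\<bar> \<le> K"
      using wv g
    proof eventually_elim
      case (elim x)
      show ?case
      proof
        assume x: "x \<in> J"
        have "ennreal (v x * (h * e x)) = ennreal (v x) * ennreal (h * e x)"
          using v by (simp add: ennreal_mult')
        also have "\<dots> \<le> ennreal (v x) * (\<integral>\<^sup>+s. norm (g (x + s) - g x) \<partial>lebesgue_on {0..h})"
          using x elim by (intro mult_left_mono e_le) auto
        also have "\<dots> = (\<integral>\<^sup>+s. ennreal (v x * norm (g (x + s) - g x)) \<partial>lebesgue_on {0..h})"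
          using v by (subst nn_integral_cmult[symmetric])
            (auto simp: ennreal_mult' intro!: measurable_lebesgue_on)
        also have "\<dots> \<le> (\<integral>\<^sup>+s. ennreal K \<partial>lebesgue_on {0..h})"
        proof (rule nn_integral_mono_AE)
          have "AE s in lebesgue_on {0..h}. v x * norm (g (x + s) - g x) \<le> K"
            using elim(1) by (simp add: AE_lebesgue_on_iff)
          then show "AE s in lebesgue_on {0..h}. ennreal (v x * norm (g (x + s) - g x)) \<le> ennreal K"
            by eventually_elim (rule ennreal_leI)
        qed
        also have "\<dots> = ennreal (K * h)"
          using h by (simp add: emeasure_restrict_space ennreal_mult K_def)
        finally have "h * (v x * e x) \<le> h * K"
          using h by (subst (asm) ennreal_le_iff) (auto simp: K_def mult_ac)
        then show "\<bar>w x * e x\<bar> \<le> K"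
          using h x elim v[of x] by (simp add: e_def abs_mult)
      qed
    qed
    then have "AE x in lebesgue_on J. \<bar>w x * e x\<bar> \<le> K" unfolding AE_J .
    moreover have "(\<lambda>x. w x * e x) \<in> borel_measurable (lebesgue_on J)" by measurable
    ultimately show ?thesis
      using True dev_meas unfolding Lp_w_def e_def by auto
  next
    case False
    define q where "q = enn2real p"
    have q: "1 \<le> q"
      using False assms(2) enn2real_mono[of 1 p] by (simp add: q_def less_top)
    let ?d = "\<lambda>s x. v x * norm (g (x + s) - g x) powr q"
    have "(\<integral>\<^sup>+x. ?d s x \<partial>lborel) < \<infinity>" if s: "0 < s" for s
    proof -
      have "integrable (lebesgue_on J) (\<lambda>t. w t * norm (diff_op s \<phi> t) powr q)"
        using \<Delta> s False by (simp add: Lp_w_def q_def)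
      then have "(\<integral>\<^sup>+t. norm (w t * norm (diff_op s \<phi> t) powr q) \<partial>lebesgue_on J) < \<infinity>"
        by (simp add: integrable_iff_bounded)
      also have "(\<integral>\<^sup>+t. norm (w t * norm (diff_op s \<phi> t) powr q) \<partial>lebesgue_on J) =
          (\<integral>\<^sup>+t\<in>J. norm (w t * norm (diff_op s \<phi> t) powr q) \<partial>lborel)"
        by (rule nn_integral_lebesgue_on[OF J])
      also have "\<dots> = (\<integral>\<^sup>+x. ?d s x \<partial>lborel)"
      proof (rule nn_integral_cong_AE)
        show "AE x in lborel. ennreal (norm (w x * norm (diff_op s \<phi> x) powr q)) * indicator J x
            = ennreal (?d s x)"
          using increment[OF s]
        proof eventually_elim
          case (elim x)
          then show ?case using v[of x] v_off[of x] by (cases "x \<in> J") (auto simp: abs_mult)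
        qed
      qed
      finally show ?thesis .
    qed
    then obtain K where K: "\<And>s. 0 < s \<Longrightarrow> s \<le> h \<Longrightarrow> (\<integral>\<^sup>+x. ?d s x \<partial>lborel) \<le> ennreal K"
      using weighted_increment_integral_bounded[OF v_meas v C h, of q] q by auto
    \<comment> \<open>Jensen in \<open>s\<close> and Tonelli reduce the claim to the bound for a single increment.\<close>
    have "ennreal h * (\<integral>\<^sup>+t. norm (w t * e t powr q) \<partial>lebesgue_on J) =
        (\<integral>\<^sup>+t. ennreal h * norm (w t * e t powr q) \<partial>lebesgue_on J)"
      by (rule nn_integral_cmult[symmetric]) measurable
    also have "\<dots> \<le> (\<integral>\<^sup>+t. (\<integral>\<^sup>+s. ?d s t \<partial>lebesgue_on {0..h}) \<partial>lebesgue_on J)"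
    proof (rule nn_integral_mono_AE, unfold AE_J)
      show "AE t in lborel. t \<in> J \<longrightarrow> ennreal h * norm (w t * e t powr q) \<le>
          (\<integral>\<^sup>+s. ?d s t \<partial>lebesgue_on {0..h})"
        using wv g
      proof eventually_elim
        case (elim t)
        show ?case
        proof
          assume t: "t \<in> J"
          have d_meas: "(\<lambda>s. norm (g (t + s) - g t)) \<in> borel_measurable (lebesgue_on {0..h})"
            by (rule measurable_lebesgue_on) measurable
          have "ennreal h * norm (w t * e t powr q) = ennreal (v t) * ennreal (h * e t powr q)"
            using elim t v[of t] h by (simp add: abs_mult mult_ac flip: ennreal_mult)
          also have "\<dots> \<le> ennreal (v t) * (\<integral>\<^sup>+s. norm (g (t + s) - g t) powr q \<partial>lebesgue_on {0..h})"
            using h t elim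
            by (intro mult_left_mono nn_integral_powr_mean_ge d_meas q e_le)
               (auto simp: e_def emeasure_restrict_space)
          also have "\<dots> = (\<integral>\<^sup>+s. ?d s t \<partial>lebesgue_on {0..h})"
            using v d_meas by (subst nn_integral_cmult[symmetric]) (auto simp: ennreal_mult')
          finally show "ennreal h * norm (w t * e t powr q) \<le> (\<integral>\<^sup>+s. ?d s t \<partial>lebesgue_on {0..h})" .
        qed
      qed
    qed
    also have "\<dots> = (\<integral>\<^sup>+t\<in>J. (\<integral>\<^sup>+s\<in>{0..h}. ?d s t \<partial>lborel) \<partial>lborel)"
      by (simp add: nn_integral_lebesgue_on J)
    also have "\<dots> \<le> (\<integral>\<^sup>+t. (\<integral>\<^sup>+s\<in>{0..h}. ?d s t \<partial>lborel) \<partial>lborel)"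
      by (intro nn_integral_mono) (auto split: split_indicator)
    also have "\<dots> = (\<integral>\<^sup>+s. (\<integral>\<^sup>+t. ennreal (?d s t) * indicator {0..h} s \<partial>lborel) \<partial>lborel)"
      by (rule lborel_pair.Fubini') measurable
    also have "\<dots> \<le> (\<integral>\<^sup>+s. ennreal K * indicator {0..h} s \<partial>lborel)"
    proof (rule nn_integral_mono)
      fix s
      show "(\<integral>\<^sup>+t. ennreal (?d s t) * indicator {0..h} s \<partial>lborel) \<le> ennreal K * indicator {0..h} s"
      proof (cases "0 < s \<and> s \<le> h")
        case True
        then show ?thesis using K[of s] by simp
      next
        case False
        then have "s \<in> {0..h} \<Longrightarrow> s = 0" by auto
        then show ?thesis by (cases "s \<in> {0..h}") auto
      qed
    qed
    also have "\<dots> = ennreal K * ennreal h" using h by (simp add: nn_integral_cmult_indicator)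
    also have "\<dots> < \<infinity>" by (simp add: ennreal_mult_less_top)
    finally have "(\<integral>\<^sup>+t. norm (w t * e t powr q) \<partial>lebesgue_on J) < \<infinity>"
      using h by (auto simp: ennreal_mult_less_top)
    then have "integrable (lebesgue_on J) (\<lambda>t. w t * e t powr q)"
      by (intro integrableI_bounded) measurable
    then show ?thesis
      using False dev_meas unfolding Lp_w_def e_def q_def by auto
  qed
qed

end
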